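(* Let $(V_1,V_2)$ be a pair of commuting isometries on a Hilbert space $\mathcal H$ such that $C(V_1,V_2)\le0$ and $C(V_1,V_2)\neq0$, and let $(\mathcal E,P,U)$ be its BCL triple with associated functions $\varphi_1,\varphi_2$. Then for each $z\in\mathbb D$, every $(\lambda_1,\lambda_2)\in\mathbb D^2$ with $\lambda_1\lambda_2=z$ is a joint eigenvalue of $(\varphi_1(z),\varphi_2(z))$, $$\sigma(\varphi_1(z),\varphi_2(z))=\{(\lambda_1,\lambda_2)\in\overline{\mathbb D^2}:\lambda_1\lambda_2=z\},$$ and $$\sigma(V_1,V_2)=\sigma(M_{\varphi_1},M_{\varphi_2})=\overline{\bigcup_{z\in\mathbb D}\sigma(\varphi_1(z),\varphi_2(z))}=\overline{\mathbb D^2}.$$ Moreover, the non-singularity breaks at stage 2 (for the Koszul complex of $(V_1-\lambda_1 I,V_2-\lambda_2I)$ at points $(\lambda_1,\lambda_2)\in\mathbb D^2$).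
   Context: Defect operator: $C(V_1,V_2)=I-V_1V_1^*-V_2V_2^*+V_1V_2V_2^*V_1^*$. For a Hilbert space $\mathcal E$, $H^2_{\mathbb D}(\mathcal E)\cong H^2_{\mathbb D}\otimes\mathcal E$ is the $\mathcal E$-valued Hardy space of the disc. Given a Hilbert space $\mathcal E$, a projection $P$ and unitary $U$ on $\mathcal E$, set $\varphi_1(z)=U^*(P^\perp+zP)$, $\varphi_2(z)=(P+zP^\perp)U$ ($z\in\mathbb D$) and let $M_{\varphi_i}$ be the multiplication operators on $H^2_{\mathbb D}(\mathcal E)$. Berger–Coburn–Lebow theorem: for commuting isometries $(V_1,V_2)$ on $\mathcal H$, $\mathcal H=\mathcal H_p\oplus\mathcal H_u$ (jointly reducing), $V_i|_{\mathcal H_u}$ commuting unitaries, and there is a triple $(\mathcal E,P,U)$, unique up to unitary equivalence, with $(V_1|_{\mathcal H_p},V_2|_{\mathcal H_p})$ unitarily equal to $(M_{\varphi_1},M_{\varphi_2})$ ($\mathcal E\cong\ker(V_1V_2)^*$); this is the BCL triple of $(V_1,V_2)$. Koszul complex of commuting $T_1,T_2$: $0\to\mathcal H\xrightarrow{\delta_1}\mathcal H\oplus\mathcal H\xrightarrow{\delta_2}\mathcal H\to0$, $\delta_1h=(T_1h,T_2h)$, $\delta_2(h_1,h_2)=T_1h_2-T_2h_1$; $\sigma(T_1,T_2)$ is the set of $(\lambda_1,\lambda_2)$ where the complex for $(T_1-\lambda_1,T_2-\lambda_2)$ is not exact; non-singularity breaks at stage $n$ if $\operatorname{ran}\delta_{n-1}\ne\ker\delta_n$.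 *)

theory Defs
  imports "HOL-Analysis.Analysis" "HOL-Library.Function_Algebras"
begin

class complex_inner = real_normed_vector +
  fixes cinner :: "'a \<Rightarrow> 'a \<Rightarrow> complex"
    and scaleC :: "complex \<Rightarrow> 'a \<Rightarrow> 'a"
  assumes scaleC_of_real: "scaleC (complex_of_real r) x = scaleR r x"
    and scaleC_add_right: "scaleC a (x + y) = scaleC a x + scaleC a y"
    and scaleC_add_left: "scaleC (a + b) x = scaleC a x + scaleC b x"
    and scaleC_scaleC: "scaleC a (scaleC b x) = scaleC (a * b) x"
    and scaleC_one: "scaleC 1 x = x"
    and cinner_commute: "cinner x y = cnj (cinner y x)"
    and cinner_add_left: "cinner (x + y) z = cinner x z + cinner y z"
    and cinner_scaleC_left: "cinner (scaleC a x) y = cnj a * cinner x y"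
    and cinner_self_nonneg: "0 \<le> Re (cinner x x)"
    and cinner_self_eq_zero: "cinner x x = 0 \<longleftrightarrow> x = 0"
    and norm_eq_sqrt_cinner: "norm x = sqrt (Re (cinner x x))"

class chilbert = complex_inner + complete_space

instantiation complex :: complex_inner
begin
definition cinner_complex :: "complex \<Rightarrow> complex \<Rightarrow> complex" where
  "cinner_complex x y = cnj x * y"
definition scaleC_complex :: "complex \<Rightarrow> complex \<Rightarrow> complex" where
  "scaleC_complex a x = a * x"
instance
proof
  fix x y z :: complex and a b :: complex and r :: real
  show "scaleC (complex_of_real r) x = scaleR r x"
    by (simp add: scaleC_complex_def scaleR_conv_of_real)
  show "scaleC a (x + y) = scaleC a x + scaleC a y"
    by (simp add: scaleC_complex_def algebra_simps)
  show "scaleC (a + b) x = scaleC a x + scaleC b x"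
    by (simp add: scaleC_complex_def algebra_simps)
  show "scaleC a (scaleC b x) = scaleC (a * b) x"
    by (simp add: scaleC_complex_def)
  show "scaleC 1 x = x" by (simp add: scaleC_complex_def)
  show "cinner x y = cnj (cinner y x)" by (simp add: cinner_complex_def)
  show "cinner (x + y) z = cinner x z + cinner y z"
    by (simp add: cinner_complex_def algebra_simps)
  show "cinner (scaleC a x) y = cnj a * cinner x y"
    by (simp add: cinner_complex_def scaleC_complex_def)
  show "0 \<le> Re (cinner x x)" by (simp add: cinner_complex_def)
  show "(cinner x x = 0) = (x = 0)" by (simp add: cinner_complex_def)
  show "norm x = sqrt (Re (cinner x x))"
    by (simp add: cinner_complex_def cmod_def power2_eq_square)
qed
end

instance complex :: chilbert ..

definition clinear_on :: "'a::complex_inner set \<Rightarrow> ('a \<Rightarrow> 'b::complex_inner) \<Rightarrow> bool" where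
  "clinear_on S T \<longleftrightarrow> (\<forall>x\<in>S. \<forall>y\<in>S. T (x + y) = T x + T y) \<and>
                       (\<forall>c. \<forall>x\<in>S. T (scaleC c x) = scaleC c (T x))"

definition bounded_clinear_op :: "('a::complex_inner \<Rightarrow> 'a) \<Rightarrow> bool" where
  "bounded_clinear_op T \<longleftrightarrow> clinear_on UNIV T \<and> (\<exists>K. \<forall>x. norm (T x) \<le> K * norm x)"

definition adj :: "('a::complex_inner \<Rightarrow> 'a) \<Rightarrow> ('a \<Rightarrow> 'a)" where
  "adj T = (THE S. \<forall>x y. cinner (T x) y = cinner x (S y))"

definition isometry_op :: "('a::complex_inner \<Rightarrow> 'a) \<Rightarrow> bool" where
  "isometry_op V \<longleftrightarrow> bounded_clinear_op V \<and> (\<forall>x. norm (V x) = norm x)"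

definition unitary_op :: "('a::complex_inner \<Rightarrow> 'a) \<Rightarrow> bool" where
  "unitary_op U \<longleftrightarrow> isometry_op U \<and> surj U"

definition orth_projection :: "('a::complex_inner \<Rightarrow> 'a) \<Rightarrow> bool" where
  "orth_projection P \<longleftrightarrow> bounded_clinear_op P \<and> (\<forall>x. P (P x) = P x) \<and>
                          (\<forall>x y. cinner (P x) y = cinner x (P y))"

definition defect_op :: "('a::complex_inner \<Rightarrow> 'a) \<Rightarrow> ('a \<Rightarrow> 'a) \<Rightarrow> 'a \<Rightarrow> 'a" where
  "defect_op V1 V2 x = x - V1 (adj V1 x) - V2 (adj V2 x) + V1 (V2 (adj V2 (adj V1 x)))"

definition op_nonpos :: "('a::complex_inner \<Rightarrow> 'a) \<Rightarrow> bool" where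
  "op_nonpos C \<longleftrightarrow> (\<forall>x. Im (cinner (C x) x) = 0 \<and> Re (cinner (C x) x) \<le> 0)"

definition closed_csubspace :: "'a::complex_inner set \<Rightarrow> bool" where
  "closed_csubspace S \<longleftrightarrow> 0 \<in> S \<and> (\<forall>x\<in>S. \<forall>y\<in>S. x + y \<in> S) \<and>
                          (\<forall>c. \<forall>x\<in>S. scaleC c x \<in> S) \<and> closed S"

text \<open>\<open>H^2_D(E)\<close> is modelled by its Taylor coefficient sequences: square-summable
sequences \<open>nat \<Rightarrow> E\<close>, with inner product the sum of the coefficientwise inner products.\<close>
definition hardy2 :: "(nat \<Rightarrow> 'e::complex_inner) set" where
  "hardy2 = {f. summable (\<lambda>n. (norm (f n))\<^sup>2)}"

definition hardy2_norm :: "(nat \<Rightarrow> 'e::complex_inner) \<Rightarrow> real" where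
  "hardy2_norm f = sqrt (\<Sum>n. (norm (f n))\<^sup>2)"

definition hardy2_scale :: "complex \<Rightarrow> (nat \<Rightarrow> 'e::complex_inner) \<Rightarrow> nat \<Rightarrow> 'e" where
  "hardy2_scale c f = (\<lambda>n. scaleC c (f n))"

text \<open>Multiplication operator by the linear operator-valued polynomial \<open>\<phi>(z) = A + z B\<close>
on coefficient sequences: \<open>(M_\<phi> f)_n = A f_n + B f_(n-1)\<close>.\<close>
definition mult_op :: "('e \<Rightarrow> 'e) \<Rightarrow> ('e \<Rightarrow> 'e) \<Rightarrow> (nat \<Rightarrow> 'e::complex_inner) \<Rightarrow> nat \<Rightarrow> 'e" where
  "mult_op A B f = (\<lambda>n. A (f n) + (if n = 0 then 0 else B (f (n - 1))))"

definition phi1 :: "('e \<Rightarrow> 'e) \<Rightarrow> ('e \<Rightarrow> 'e) \<Rightarrow> complex \<Rightarrow> 'e \<Rightarrow> 'e::complex_inner" where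
  "phi1 P U z x = adj U ((x - P x) + scaleC z (P x))"

definition phi2 :: "('e \<Rightarrow> 'e) \<Rightarrow> ('e \<Rightarrow> 'e) \<Rightarrow> complex \<Rightarrow> 'e \<Rightarrow> 'e::complex_inner" where
  "phi2 P U z x = P (U x) + scaleC z (U x - P (U x))"

definition M_phi1 :: "('e \<Rightarrow> 'e) \<Rightarrow> ('e \<Rightarrow> 'e) \<Rightarrow> (nat \<Rightarrow> 'e) \<Rightarrow> nat \<Rightarrow> 'e::complex_inner" where
  "M_phi1 P U = mult_op (\<lambda>x. adj U (x - P x)) (\<lambda>x. adj U (P x))"

definition M_phi2 :: "('e \<Rightarrow> 'e) \<Rightarrow> ('e \<Rightarrow> 'e) \<Rightarrow> (nat \<Rightarrow> 'e) \<Rightarrow> nat \<Rightarrow> 'e::complex_inner" where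
  "M_phi2 P U = mult_op (\<lambda>x. P (U x)) (\<lambda>x. U x - P (U x))"

text \<open>\<open>(UNIV :: 'e set, P, U)\<close> is a BCL triple of \<open>(V1,V2)\<close>: Berger--Coburn--Lebow
decomposition \<open>H = H_p \<oplus> H_u\<close> into jointly reducing closed subspaces, with
\<open>V_i|H_u\<close> unitary and \<open>(V1|H_p, V2|H_p)\<close> unitarily equivalent via \<open>W\<close> to
\<open>(M_\<phi>1, M_\<phi>2)\<close> on \<open>H^2_D(E)\<close>.\<close>
definition is_BCL_triple ::
  "('h::complex_inner \<Rightarrow> 'h) \<Rightarrow> ('h \<Rightarrow> 'h) \<Rightarrow> ('e::complex_inner \<Rightarrow> 'e) \<Rightarrow> ('e \<Rightarrow> 'e) \<Rightarrow> bool" where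
  "is_BCL_triple V1 V2 P U \<longleftrightarrow> orth_projection P \<and> unitary_op U \<and>
     (\<exists>Hp Hu (W :: 'h \<Rightarrow> nat \<Rightarrow> 'e).
        closed_csubspace Hp \<and> closed_csubspace Hu \<and>
        (\<forall>x\<in>Hp. \<forall>y\<in>Hu. cinner x y = 0) \<and>
        (\<forall>h. \<exists>x\<in>Hp. \<exists>y\<in>Hu. h = x + y) \<and>
        V1 ` Hp \<subseteq> Hp \<and> V2 ` Hp \<subseteq> Hp \<and>
        V1 ` Hu = Hu \<and> V2 ` Hu = Hu \<and>
        bij_betw W Hp hardy2 \<and>
        (\<forall>x\<in>Hp. \<forall>y\<in>Hp. W (x + y) = W x + W y) \<and>
        (\<forall>c. \<forall>x\<in>Hp. W (scaleC c x) = hardy2_scale c (W x)) \<and>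
        (\<forall>x\<in>Hp. hardy2_norm (W x) = norm x) \<and>
        (\<forall>x\<in>Hp. W (V1 x) = M_phi1 P U (W x)) \<and>
        (\<forall>x\<in>Hp. W (V2 x) = M_phi2 P U (W x)))"

text \<open>Koszul complex of \<open>(A1,A2)\<close> on a space \<open>S\<close>:
\<open>0 \<rightarrow> S \<rightarrow>\<delta>1 S\<oplus>S \<rightarrow>\<delta>2 S \<rightarrow> 0\<close>, \<open>\<delta>1 h = (A1 h, A2 h)\<close>, \<open>\<delta>2 (h1,h2) = A1 h2 - A2 h1\<close>.\<close>
definition koszul_ran1 :: "'a set \<Rightarrow> ('a \<Rightarrow> 'a) \<Rightarrow> ('a \<Rightarrow> 'a) \<Rightarrow> ('a \<times> 'a) set" where
  "koszul_ran1 S A1 A2 = (\<lambda>h. (A1 h, A2 h)) ` S"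

definition koszul_ker1 :: "'a::ab_group_add set \<Rightarrow> ('a \<Rightarrow> 'a) \<Rightarrow> ('a \<Rightarrow> 'a) \<Rightarrow> 'a set" where
  "koszul_ker1 S A1 A2 = {h \<in> S. A1 h = 0 \<and> A2 h = 0}"

definition koszul_ker2 :: "'a::ab_group_add set \<Rightarrow> ('a \<Rightarrow> 'a) \<Rightarrow> ('a \<Rightarrow> 'a) \<Rightarrow> ('a \<times> 'a) set" where
  "koszul_ker2 S A1 A2 = {(h1, h2). h1 \<in> S \<and> h2 \<in> S \<and> A1 h2 - A2 h1 = 0}"

definition koszul_ran2 :: "'a::ab_group_add set \<Rightarrow> ('a \<Rightarrow> 'a) \<Rightarrow> ('a \<Rightarrow> 'a) \<Rightarrow> 'a set" where
  "koszul_ran2 S A1 A2 = {A1 h2 - A2 h1 | h1 h2. h1 \<in> S \<and> h2 \<in> S}"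

definition koszul_exact :: "'a::ab_group_add set \<Rightarrow> ('a \<Rightarrow> 'a) \<Rightarrow> ('a \<Rightarrow> 'a) \<Rightarrow> bool" where
  "koszul_exact S A1 A2 \<longleftrightarrow> koszul_ker1 S A1 A2 = {0} \<and>
     koszul_ran1 S A1 A2 = koszul_ker2 S A1 A2 \<and> koszul_ran2 S A1 A2 = S"

definition taylor_spectrum ::
  "'a::ab_group_add set \<Rightarrow> (complex \<Rightarrow> 'a \<Rightarrow> 'a) \<Rightarrow> ('a \<Rightarrow> 'a) \<Rightarrow> ('a \<Rightarrow> 'a) \<Rightarrow> (complex \<times> complex) set" where
  "taylor_spectrum S sc T1 T2 =
     {(l1, l2). \<not> koszul_exact S (\<lambda>x. T1 x - sc l1 x) (\<lambda>x. T2 x - sc l2 x)}"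

definition joint_eigenvalue :: "('a::complex_inner \<Rightarrow> 'a) \<Rightarrow> ('a \<Rightarrow> 'a) \<Rightarrow> complex \<times> complex \<Rightarrow> bool" where
  "joint_eigenvalue T1 T2 l \<longleftrightarrow>
     (\<exists>x. x \<noteq> 0 \<and> T1 x = scaleC (fst l) x \<and> T2 x = scaleC (snd l) x)"

definition breaks_at_stage2 :: "'a::ab_group_add set \<Rightarrow> ('a \<Rightarrow> 'a) \<Rightarrow> ('a \<Rightarrow> 'a) \<Rightarrow> bool" where
  "breaks_at_stage2 S A1 A2 \<longleftrightarrow> koszul_ran1 S A1 A2 \<noteq> koszul_ker2 S A1 A2"

end

theory Submission
  imports Defs
begin

text \<open>On the wandering space of \<open>V1 V2\<close> the defect operator is \<open>U\<^sup>* P U - P\<close>, and it vanishes on the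
orthogonal complement. So the hypotheses provide a vector \<open>e \<noteq> 0\<close> with \<open>P e = e\<close>, \<open>P (U e) = 0\<close>, and
the orthogonal sequence \<open>(U\<^sup>*)\<^sup>n e\<close>, \<open>n \<in> \<int>\<close>, lies in the range of \<open>P\<close> for \<open>n \<ge> 0\<close> and in its
kernel for \<open>n < 0\<close>. Geometric series along it give the joint eigenvectors of the fibres; dividing
the resulting functions \<open>(\<phi>i - li) x\<close> by the variable minus \<open>l1 l2\<close> gives a cycle of the Koszul
complex of \<open>(V1 - l1, V2 - l2)\<close> that is not a boundary. On the boundary of the bidisc, truncated
series are approximate joint eigenvectors of the adjoints, so by uniform boundedness the last map
of the complex is not onto. Outside the closed bidisc, one of the operators \<open>Vi - li\<close> is invertible.\<close>

subsection \<open>Complex inner product spaces\<close>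

text \<open>Closedness of the Taylor spectrum would yield the boundary of the bidisc from its
  interior at once; here the boundary is treated directly, and fibres and isometries need different
  care. On a fibre the identity \<open>phi1 phi2 = z\<close> confines the spectrum to
  \<open>l1 * l2 = z\<close> and passes an estimate for one operator on to the other, so a single
  shift suffices. The isometries satisfy no such relation: their test vectors are first made exact
  eigenvectors of one adjoint by a resolvent, then summed along the shift given by the other
  adjoint, and a limit reaches the points where both moduli are 1. In the open bidisc the fibres
  already fail at the first map of the complex, but the isometries cannot, since an isometry has no
  eigenvalue of modulus below 1; this is why a cycle without primitive is needed there.\<close>

lemma cinner_add_right: "cinner x (y + z) = cinner x y + cinner x (z::'a::complex_inner)"
  by (metis cinner_add_left cinner_commute complex_cnj_add)

lemma cinner_scaleC_right: "cinner x (scaleC a y) = a * cinner x (y::'a::complex_inner)"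
  by (metis cinner_commute cinner_scaleC_left complex_cnj_cnj complex_cnj_mult)

lemma scaleC_minus_one: "scaleC (-1) x = - (x::'a::complex_inner)"
  using scaleC_of_real[of "-1" x] by simp

lemma scaleC_zero_left [simp]: "scaleC 0 x = (0::'a::complex_inner)"
  using scaleC_of_real[of 0 x] by simp

lemma scaleC_zero_right [simp]: "scaleC c 0 = (0::'a::complex_inner)"
  using scaleC_add_right[of c 0 0] by simp

lemma scaleC_minus_right: "scaleC c (- x) = - scaleC c (x::'a::complex_inner)"
  using scaleC_add_right[of c x "-x"] by (simp add: eq_neg_iff_add_eq_0 add.commute)

lemma scaleC_minus_left: "scaleC (- c) x = - scaleC c (x::'a::complex_inner)"
  using scaleC_add_left[of c "-c" x] by (simp add: eq_neg_iff_add_eq_0 add.commute)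

lemma scaleC_diff_right: "scaleC c (x - y) = scaleC c x - scaleC c (y::'a::complex_inner)"
  using scaleC_add_right[of c x "-y"] by (simp add: scaleC_minus_right)

lemma scaleC_diff_left: "scaleC (a - b) x = scaleC a x - scaleC b (x::'a::complex_inner)"
  using scaleC_add_left[of a "-b" x] by (simp add: scaleC_minus_left)

lemma cinner_minus_left: "cinner (- x) y = - cinner x (y::'a::complex_inner)"
  using cinner_scaleC_left[of "-1" x y] by (simp add: scaleC_minus_one)

lemma cinner_minus_right: "cinner x (- y) = - cinner x (y::'a::complex_inner)"
  using cinner_scaleC_right[of x "-1" y] by (simp add: scaleC_minus_one)

lemma cinner_zero_left [simp]: "cinner 0 (y::'a::complex_inner) = 0"
  using cinner_add_left[of 0 0 y] by simp

lemma cinner_zero_right [simp]: "cinner (x::'a::complex_inner) 0 = 0"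
  using cinner_add_right[of x 0 0] by simp

lemma cinner_diff_left: "cinner (x - y) z = cinner x z - cinner y (z::'a::complex_inner)"
  using cinner_add_left[of x "-y" z] by (simp add: cinner_minus_left)

lemma cinner_diff_right: "cinner x (y - z) = cinner x y - cinner x (z::'a::complex_inner)"
  using cinner_add_right[of x y "-z"] by (simp add: cinner_minus_right)

lemma cinner_sum_right: "cinner x (sum f A) = (\<Sum>i\<in>A. cinner x (f i :: 'a::complex_inner))"
  by (induction A rule: infinite_finite_induct) (auto simp: cinner_add_right)

lemma cinner_sum_left: "cinner (sum f A) x = (\<Sum>i\<in>A. cinner (f i :: 'a::complex_inner) x)"
  by (induction A rule: infinite_finite_induct) (auto simp: cinner_add_left)

lemma cinner_self: "cinner x x = complex_of_real ((norm (x::'a::complex_inner))\<^sup>2)"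
proof -
  have "Im (cinner x x) = 0"
    using arg_cong[OF cinner_commute[of x x], of Im] by simp
  moreover have "Re (cinner x x) = (norm x)\<^sup>2"
    using cinner_self_nonneg[of x] by (simp add: norm_eq_sqrt_cinner)
  ultimately show ?thesis by (simp add: complex_eq_iff)
qed

lemma norm_scaleC: "norm (scaleC c x) = cmod c * norm (x::'a::complex_inner)"
proof -
  have "cinner (scaleC c x) (scaleC c x) = (c * cnj c) * cinner x x"
    by (simp add: cinner_scaleC_left cinner_scaleC_right)
  then have "complex_of_real ((norm (scaleC c x))\<^sup>2) = complex_of_real ((cmod c * norm x)\<^sup>2)"
    by (simp only: cinner_self complex_norm_square[symmetric] power_mult_distrib of_real_mult)
  then have "(norm (scaleC c x))\<^sup>2 = (cmod c * norm x)\<^sup>2"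
    using of_real_eq_iff by blast
  then show ?thesis by (simp add: power2_eq_iff_nonneg)
qed

lemma norm_add_sq:
  "(norm (x + y))\<^sup>2 = (norm x)\<^sup>2 + (norm (y::'a::complex_inner))\<^sup>2 + 2 * Re (cinner x y)"
proof -
  have "complex_of_real ((norm (x + y))\<^sup>2)
      = complex_of_real ((norm x)\<^sup>2 + (norm y)\<^sup>2) + (cinner x y + cnj (cinner x y))"
    unfolding cinner_self[symmetric] of_real_add
    by (simp add: cinner_add_left cinner_add_right cinner_commute[of y x])
  then show ?thesis
    by (metis Re_complex_of_real complex_add_cnj of_real_add)
qed

lemma cinner_Cauchy_Schwarz: "cmod (cinner x y) \<le> norm x * norm (y::'a::complex_inner)"
proof (cases "x = 0")
  case False
  define s where "s = (norm x)\<^sup>2"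
  define w where "w = cinner x y"
  have s: "s > 0" using False by (simp add: s_def)
  have "(norm (scaleC (- w / of_real s) x))\<^sup>2 = (cmod w)\<^sup>2 / s"
    using s by (simp add: norm_scaleC norm_divide power_mult_distrib power_divide
        power2_eq_square[of s] flip: s_def)
  moreover have "cinner y (scaleC (- w / of_real s) x) = (- w / of_real s) * cnj w"
    by (simp add: cinner_scaleC_right w_def cinner_commute[of y x])
  moreover have "0 \<le> (norm (y + scaleC (- w / of_real s) x))\<^sup>2" by simp
  ultimately have "0 \<le> (norm y)\<^sup>2 + (cmod w)\<^sup>2 / s + 2 * Re ((- w / of_real s) * cnj w)"
    unfolding norm_add_sq by simp
  also have "(- w / of_real s) * cnj w = of_real (- (cmod w)\<^sup>2 / s)"
    by (simp add: complex_norm_square[symmetric] flip: of_real_power)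
  finally have "(cmod w)\<^sup>2 \<le> (norm y)\<^sup>2 * s"
    using s by (simp add: field_simps power2_eq_square)
  then have "(cmod w)\<^sup>2 \<le> (norm x * norm y)\<^sup>2"
    by (simp add: s_def power_mult_distrib mult.commute)
  then show ?thesis unfolding w_def by (simp add: power2_le_iff_abs_le)
qed simp

lemma cinner_eqI_left:
  assumes "\<And>x. cinner x y = cinner x (z::'a::complex_inner)"
  shows "y = z"
proof -
  have "cinner (y - z) (y - z) = 0"
    using assms[of "y - z"] by (simp add: cinner_diff_right)
  then show ?thesis by (simp add: cinner_self_eq_zero)
qed

lemma bounded_linear_cinner_left: "bounded_linear (\<lambda>g. cinner g (u::'a::complex_inner))"
proof (rule bounded_linear_intro[of _ "norm u"])
  fix r :: real and x :: 'a
  show "cinner (r *\<^sub>R x) u = r *\<^sub>R cinner x u"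
    by (simp add: cinner_scaleC_left scaleR_conv_of_real flip: scaleC_of_real[where 'a='a])
qed (use cinner_Cauchy_Schwarz in \<open>auto simp: cinner_add_left\<close>)

text \<open>The uniform boundedness principle for the functionals \<open>cinner _ u\<close>, by Baire's theorem.\<close>
lemma pointwise_bounded_imp_norm_bounded:
  fixes B :: "'a::chilbert set"
  assumes "\<And>g. \<exists>M. \<forall>u\<in>B. cmod (cinner g u) \<le> M"
  obtains M where "\<And>u. u \<in> B \<Longrightarrow> norm u \<le> M"
proof -
  define F where "F n = {g. \<forall>u\<in>B. cmod (cinner g u) \<le> real n}" for n
  have closed: "closed (F n)" for n
  proof -
    have "F n = (\<Inter>u\<in>B. {g. cmod (cinner g u) \<le> real n})" by (auto simp: F_def)
    moreover have "closed {g. cmod (cinner g u) \<le> real n}" for u :: 'a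
      by (intro closed_Collect_le continuous_intros
          bounded_linear.continuous_on[OF bounded_linear_cinner_left])
    ultimately show ?thesis by auto
  qed
  have cover: "g \<in> (\<Union>n. F n)" for g
  proof -
    obtain M where "\<forall>u\<in>B. cmod (cinner g u) \<le> M" using assms by blast
    moreover obtain n where "M \<le> real n" using real_arch_simple by blast
    ultimately have "g \<in> F n" unfolding F_def by (auto intro: order_trans)
    then show ?thesis by blast
  qed
  have "\<exists>n. interior (F n) \<noteq> {}"
  proof (rule ccontr)
    assume "\<not> ?thesis"
    moreover have "Met_TC.mcomplete TYPE('a)"
      unfolding mcomplete_iff_complete by (rule complete_UNIV)
    ultimately have "Met_TC.mtopology interior_of (\<Union> (range F)) = {}"
      using closed by (intro Met_TC.metric_Baire_category_alt) auto
    moreover have "\<Union> (range F) = UNIV" using cover by blast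
    ultimately show False by simp
  qed
  then obtain n g0 where "g0 \<in> interior (F n)" by blast
  then obtain r where r: "r > 0" "cball g0 r \<subseteq> F n" by (meson mem_interior_cball)
  have "norm u \<le> 2 * real n / r" if u: "u \<in> B" for u
  proof (cases "u = 0")
    case False
    define v where "v = scaleR (r / norm u) u"
    have "norm v = r" using False r(1) by (simp add: v_def)
    then have "g0 + v \<in> F n" "g0 \<in> F n" using r by (auto simp: subset_iff dist_norm)
    then have "cmod (cinner (g0 + v) u) \<le> n" "cmod (cinner g0 u) \<le> n"
      using u by (auto simp: F_def)
    moreover have "cinner v u = cinner (g0 + v) u - cinner g0 u" by (simp add: cinner_add_left)
    ultimately have "cmod (cinner v u) \<le> 2 * real n"
      using norm_triangle_ineq4[of "cinner (g0 + v) u" "cinner g0 u"] by simp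
    moreover have "cinner v u = of_real (r * norm u)"
      using False
      by (simp add: v_def scaleC_of_real[symmetric] cinner_scaleC_left cinner_self power2_eq_square)
    ultimately have "r * norm u \<le> 2 * real n" using r(1) by (simp add: norm_mult)
    then show ?thesis using r(1) by (simp add: field_simps)
  qed (use r in auto)
  then show ?thesis using that by blast
qed

subsection \<open>Linear contractions and isometries\<close>

lemma clinear_add: "clinear_on UNIV T \<Longrightarrow> T (x + y) = T x + T y"
  and clinear_scaleC: "clinear_on UNIV T \<Longrightarrow> T (scaleC c x) = scaleC c (T x)"
  by (simp_all add: clinear_on_def)

lemma clinear_zero: "clinear_on UNIV T \<Longrightarrow> T 0 = 0"
  using clinear_scaleC[of T 0 0] by simp

lemma clinear_minus: "clinear_on UNIV T \<Longrightarrow> T (- x) = - T x"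
  using clinear_scaleC[of T "-1" x] by (simp add: scaleC_minus_one)

lemma clinear_diff: "clinear_on UNIV T \<Longrightarrow> T (x - y) = T x - T y"
  using clinear_add[of T x "-y"] by (simp add: clinear_minus)

lemmas clinear_simps = clinear_add clinear_scaleC clinear_zero clinear_minus clinear_diff

lemma isometry_clinear: "isometry_op V \<Longrightarrow> clinear_on UNIV V"
  and isometry_norm: "isometry_op V \<Longrightarrow> norm (V x) = norm x"
  by (simp_all add: isometry_op_def bounded_clinear_op_def)

text \<open>Polarization: norms of sums fix the real part of the inner product, and replacing
  \<open>y\<close> by \<open>scaleC (- \<i>) y\<close> turns the imaginary part into a real
  one.\<close>

lemma isometry_cinner:
  assumes "isometry_op V" shows "cinner (V x) (V y) = cinner x y"
proof -
  note lin = isometry_clinear[OF assms]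
  have Re: "Re (cinner (V x) (V y)) = Re (cinner x y)" for x y
    using norm_add_sq[of "V x" "V y"] norm_add_sq[of x y]
    by (simp add: isometry_norm[OF assms] flip: clinear_add[OF lin])
  have "Im (cinner (V x) (V y)) = Im (cinner x y)"
    using Re[of x "scaleC (- \<i>) y"] by (simp add: clinear_scaleC[OF lin] cinner_scaleC_right)
  then show ?thesis using Re by (simp add: complex_eq_iff)
qed

lemma csubspace_add: "closed_csubspace K \<Longrightarrow> x \<in> K \<Longrightarrow> y \<in> K \<Longrightarrow> x + y \<in> K"
  and csubspace_scaleC: "closed_csubspace K \<Longrightarrow> x \<in> K \<Longrightarrow> scaleC c x \<in> K"
  and csubspace_zero: "closed_csubspace K \<Longrightarrow> 0 \<in> K"
  by (simp_all add: closed_csubspace_def)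

lemma csubspace_minus: "closed_csubspace K \<Longrightarrow> x \<in> K \<Longrightarrow> - x \<in> K"
  using csubspace_scaleC[of K x "-1"] by (simp add: scaleC_minus_one)

lemma csubspace_diff: "closed_csubspace K \<Longrightarrow> x \<in> K \<Longrightarrow> y \<in> K \<Longrightarrow> x - y \<in> K"
  using csubspace_add[of K x "-y"] csubspace_minus[of K y] by simp

lemma csubspace_sum:
  "closed_csubspace K \<Longrightarrow> (\<And>i. i \<in> A \<Longrightarrow> f i \<in> K) \<Longrightarrow> sum f A \<in> K"
  by (induction A rule: infinite_finite_induct) (auto simp: csubspace_zero csubspace_add)

lemma closed_csubspace_UNIV: "closed_csubspace UNIV"
  by (simp add: closed_csubspace_def)

text \<open>A fixed-point form of the Neumann series for the inverse of \<open>1 - c T\<close>.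
  Existence keeps the solution in the invariant subspace; uniqueness later identifies vectors that
  solve the same equation.\<close>

lemma contraction_resolvent:
  fixes T :: "'a::chilbert \<Rightarrow> 'a"
  assumes K: "closed_csubspace K" "T ` K \<subseteq> K" and lin: "clinear_on UNIV T"
    and contr: "\<And>x. norm (T x) \<le> norm x" and c: "cmod c < 1" and a: "a \<in> K"
  shows "\<exists>!w\<in>K. w = a + scaleC c (T w)"
proof -
  have "\<exists>!w\<in>K. a + scaleC c (T w) = w"
  proof (rule Banach_fix[where c = "cmod c"])
    show "complete K" "K \<noteq> {}"
      using K a by (auto simp: closed_csubspace_def complete_eq_closed)
    show "(\<lambda>w. a + scaleC c (T w)) ` K \<subseteq> K"
      using K a by (auto intro!: csubspace_add csubspace_scaleC)
    fix x y
    have "dist (a + scaleC c (T x)) (a + scaleC c (T y)) = cmod c * norm (T (x - y))"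
      by (simp add: dist_norm clinear_diff[OF lin] norm_scaleC flip: scaleC_diff_right)
    also have "\<dots> \<le> cmod c * dist x y"
      using contr[of "x - y"] by (simp add: dist_norm mult_left_mono)
    finally show "dist (a + scaleC c (T x)) (a + scaleC c (T y)) \<le> cmod c * dist x y" .
  qed (use c in auto)
  then show ?thesis by metis
qed

text \<open>Dividing by \<open>l\<close> turns \<open>T w - scaleC l w = y\<close> into the
  resolvent equation with \<open>c = 1 / l\<close>. It is solved inside \<open>K\<close>, so that
  the inverse maps \<open>K\<close> into itself.\<close>

lemma contraction_minus_scalar_bij:
  fixes T :: "'a::chilbert \<Rightarrow> 'a"
  assumes K: "closed_csubspace K" "T ` K \<subseteq> K" and lin: "clinear_on UNIV T"
    and contr: "\<And>x. norm (T x) \<le> norm x" and l: "cmod l > 1"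
  shows "bij_betw (\<lambda>x. T x - scaleC l x) K K"
proof (rule bij_betw_byWitness[where f' = "\<lambda>y. THE w. w \<in> K \<and> T w - scaleC l w = y"])
  have eq: "T w - scaleC l w = y \<longleftrightarrow> w = scaleC (- (1 / l)) y + scaleC (1 / l) (T w)" for w y
  proof -
    have l0: "l \<noteq> 0" using l by auto
    have "T w - scaleC l w = y \<longleftrightarrow> scaleC l w = T w - y" by (auto simp: algebra_simps)
    also have "\<dots> \<longleftrightarrow> w = scaleC (1 / l) (T w - y)"
      using l0 by (metis nonzero_divide_eq_eq scaleC_one scaleC_scaleC mult.commute)
    finally show ?thesis by (simp add: scaleC_diff_right scaleC_minus_left)
  qed
  have "cmod (1 / l) < 1" using l by (auto simp: norm_divide divide_less_eq_1)
  then have ex1: "\<exists>!w. w \<in> K \<and> T w - scaleC l w = y" if "y \<in> K" for y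
    unfolding eq using contraction_resolvent[OF K lin contr, of "1 / l" "scaleC (- (1 / l)) y"] that
    by (simp add: csubspace_scaleC[OF K(1)])
  have maps: "T w - scaleC l w \<in> K" if "w \<in> K" for w
    using K that by (auto intro!: csubspace_diff csubspace_scaleC)
  show "\<forall>a\<in>K. (THE w. w \<in> K \<and> T w - scaleC l w = T a - scaleC l a) = a"
    using ex1 maps by (auto intro!: the1_equality)
  show "\<forall>a\<in>K. T (THE w. w \<in> K \<and> T w - scaleC l w = a)
      - scaleC l (THE w. w \<in> K \<and> T w - scaleC l w = a) = a"
    using theI'[OF ex1] by auto
  show "(\<lambda>y. THE w. w \<in> K \<and> T w - scaleC l w = y) ` K \<subseteq> K"
    using theI'[OF ex1] by auto
qed (use K in \<open>auto intro!: csubspace_diff csubspace_scaleC\<close>)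

subsection \<open>Exactness of Koszul complexes\<close>

text \<open>Exactness of a Koszul complex is a statement about abelian groups, so the algebra below
  asks only for additivity on \<open>S\<close>.\<close>

definition additive_endo :: "'a::ab_group_add set \<Rightarrow> ('a \<Rightarrow> 'a) \<Rightarrow> bool" where
  "additive_endo S T \<longleftrightarrow> T ` S \<subseteq> S \<and> (\<forall>x\<in>S. \<forall>y\<in>S. T (x + y) = T x + T y)"

text \<open>\<open>A'\<close> and \<open>B'\<close> form a contracting homotopy: a cycle
  \<open>(h1, h2)\<close> has the primitive \<open>A' h1 + B' h2\<close>, and \<open>g\<close> is
  the image of the pair \<open>(- B' g, A' g)\<close> under the last map.\<close>

lemma koszul_exact_if_bezout:
  assumes S: "0 \<in> S" "\<And>x y. x \<in> S \<Longrightarrow> y \<in> S \<Longrightarrow> x + y \<in> S" "\<And>x. x \<in> S \<Longrightarrow> - x \<in> S"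
    and endo: "additive_endo S A" "additive_endo S B" "additive_endo S A'" "additive_endo S B'"
    and comm: "\<And>x. x \<in> S \<Longrightarrow> A (B x) = B (A x)" "\<And>x. x \<in> S \<Longrightarrow> A (A' x) = A' (A x)"
      "\<And>x. x \<in> S \<Longrightarrow> A (B' x) = B' (A x)" "\<And>x. x \<in> S \<Longrightarrow> B (A' x) = A' (B x)"
      "\<And>x. x \<in> S \<Longrightarrow> B (B' x) = B' (B x)"
    and one: "\<And>x. x \<in> S \<Longrightarrow> A' (A x) + B' (B x) = x"
  shows "koszul_exact S A B"
proof -
  have maps: "T x \<in> S" if "additive_endo S T" "x \<in> S" for T x
    using that by (auto simp: additive_endo_def)
  have add: "T (x + y) = T x + T y" if "additive_endo S T" "x \<in> S" "y \<in> S" for T x y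
    using that by (auto simp: additive_endo_def)
  have zero: "T 0 = 0" if "additive_endo S T" for T
    using add[OF that S(1) S(1)] by simp
  have minus: "T (- x) = - T x" if "additive_endo S T" "x \<in> S" for T x
    using add[OF that S(3)[OF that(2)]] zero[OF that(1)] by (simp add: eq_neg_iff_add_eq_0 add.commute)
  note mem = maps[OF endo(1)] maps[OF endo(2)] maps[OF endo(3)] maps[OF endo(4)]
  have "h = 0" if "h \<in> S" "A h = 0" "B h = 0" for h
    using one[OF that(1)] that by (simp add: zero endo)
  then have "koszul_ker1 S A B = {0}"
    using S(1) by (auto simp: koszul_ker1_def zero endo)
  moreover have "koszul_ran1 S A B = koszul_ker2 S A B"
  proof (intro equalityI subsetI)
    fix p assume "p \<in> koszul_ker2 S A B"
    then obtain h1 h2 where p: "p = (h1, h2)" "h1 \<in> S" "h2 \<in> S" "A h2 = B h1"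
      by (auto simp: koszul_ker2_def)
    define h where "h = A' h1 + B' h2"
    have "A h = A' (A h1) + B' (B h1)"
      using p by (simp add: h_def add endo mem comm)
    then have "A h = h1" using one p by simp
    moreover have "B h = A' (A h2) + B' (B h2)"
      using p by (simp add: h_def add endo mem comm)
    then have "B h = h2" using one[of h2] p by simp
    moreover have "h \<in> S" using p by (simp add: h_def mem S)
    ultimately show "p \<in> koszul_ran1 S A B" using p by (auto simp: koszul_ran1_def)
  qed (auto simp: koszul_ran1_def koszul_ker2_def mem comm)
  moreover have "koszul_ran2 S A B = S"
  proof (intro equalityI subsetI)
    fix g assume g: "g \<in> S"
    have "g = A (A' g) - B (- B' g)"
      using one[OF g] g by (simp add: minus endo mem comm)
    moreover have "A' g \<in> S" "- B' g \<in> S" using g by (simp_all add: mem S)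
    ultimately show "g \<in> koszul_ran2 S A B" unfolding koszul_ran2_def by blast
  next
    fix g assume "g \<in> koszul_ran2 S A B"
    then obtain h1 h2 where "g = A h2 - B h1" "h1 \<in> S" "h2 \<in> S" by (auto simp: koszul_ran2_def)
    then show "g \<in> S" using S(2)[of "A h2" "- B h1"] by (simp add: S mem)
  qed
  ultimately show ?thesis by (simp add: koszul_exact_def)
qed

lemma additive_endo_inv_into:
  assumes "additive_endo S A" "bij_betw A S S" "\<And>x y. x \<in> S \<Longrightarrow> y \<in> S \<Longrightarrow> x + y \<in> S"
  shows "additive_endo S (inv_into S A)"
  unfolding additive_endo_def
proof (intro conjI ballI)
  show maps: "inv_into S A ` S \<subseteq> S"
    using bij_betw_inv_into[OF assms(2)] by (simp add: bij_betw_def)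
  fix x y assume xy: "x \<in> S" "y \<in> S"
  have mem: "inv_into S A x \<in> S" "inv_into S A y \<in> S" using maps xy by auto
  have "A (inv_into S A x + inv_into S A y) = x + y"
    using assms(1,2) mem xy by (simp add: additive_endo_def bij_betw_inv_into_right)
  then show "inv_into S A (x + y) = inv_into S A x + inv_into S A y"
    using assms(2,3) mem bij_betw_inv_into_left[OF assms(2)] by metis
qed

lemma koszul_exact_if_bij:
  assumes S: "0 \<in> S" "\<And>x y. x \<in> S \<Longrightarrow> y \<in> S \<Longrightarrow> x + y \<in> S" "\<And>x. x \<in> S \<Longrightarrow> - x \<in> S"
    and endo: "additive_endo S A" "additive_endo S B"
    and comm: "\<And>x. x \<in> S \<Longrightarrow> A (B x) = B (A x)"
    and bij: "bij_betw A S S \<or> bij_betw B S S"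
  shows "koszul_exact S A B"
proof -
  have inv_comm: "D (inv_into S C x) = inv_into S C (D x)"
    if "bij_betw C S S" "additive_endo S D" "\<And>x. x \<in> S \<Longrightarrow> C (D x) = D (C x)" "x \<in> S" for C D x
  proof -
    have mem: "inv_into S C x \<in> S"
      using that bij_betw_inv_into[OF that(1)] by (auto simp: bij_betw_def)
    then have "C (D (inv_into S C x)) = D x"
      using that by (simp add: bij_betw_inv_into_right)
    moreover have "D (inv_into S C x) \<in> S" using mem that by (auto simp: additive_endo_def)
    ultimately show ?thesis using bij_betw_inv_into_left[OF that(1)] by metis
  qed
  have endo0: "additive_endo S (\<lambda>x. 0)" using S by (auto simp: additive_endo_def)
  have zero: "T 0 = 0" if "additive_endo S T" for T
  proof -
    have "T (0 + 0) = T 0 + T 0" using that S(1) unfolding additive_endo_def by blast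
    then show ?thesis by simp
  qed
  from bij show ?thesis
  proof
    assume b: "bij_betw A S S"
    show ?thesis
      by (rule koszul_exact_if_bezout[where A' = "inv_into S A" and B' = "\<lambda>x. 0"])
        (use b S endo comm endo0 in \<open>auto intro!: inv_comm additive_endo_inv_into
          simp: zero bij_betw_inv_into_left bij_betw_inv_into_right\<close>)
  next
    assume b: "bij_betw B S S"
    show ?thesis
      by (rule koszul_exact_if_bezout[where B' = "inv_into S B" and A' = "\<lambda>x. 0"])
        (use b S endo comm endo0 in \<open>auto intro!: inv_comm additive_endo_inv_into
          simp: zero bij_betw_inv_into_left bij_betw_inv_into_right\<close>)
  qed
qed

text \<open>An isomorphism of complexes, acting componentwise on pairs. It carries exactness from
  \<open>Hp\<close>, where the Hilbert space estimates are made, to the Hardy space along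
  \<open>W\<close>.\<close>

lemma koszul_exact_transfer:
  fixes S :: "'a::ab_group_add set" and S' :: "'b::ab_group_add set"
  assumes S: "0 \<in> S" "\<And>x y. x \<in> S \<Longrightarrow> y \<in> S \<Longrightarrow> x - y \<in> S"
    and f: "bij_betw f S S'" "\<And>x y. x \<in> S \<Longrightarrow> y \<in> S \<Longrightarrow> f (x - y) = f x - f y"
    and maps: "A ` S \<subseteq> S" "B ` S \<subseteq> S"
    and int: "\<And>x. x \<in> S \<Longrightarrow> f (A x) = A' (f x)" "\<And>x. x \<in> S \<Longrightarrow> f (B x) = B' (f x)"
  shows "koszul_exact S' A' B' \<longleftrightarrow> koszul_exact S A B"
proof -
  have f0: "f 0 = 0" using f(2)[OF S(1) S(1)] by simp
  have S': "S' = f ` S" and inj: "inj_on f S" using f(1) by (auto simp: bij_betw_def)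
  have eq0: "f x = 0 \<longleftrightarrow> x = 0" if "x \<in> S" for x using inj that S(1) f0 by (metis inj_onD)
  have mem: "A x \<in> S" "B x \<in> S" if "x \<in> S" for x using maps that by auto
  let ?ff = "\<lambda>(x, y). (f x, f y)"
  have injff: "inj_on ?ff (S \<times> S)" using inj by (auto simp: inj_on_def)
  have "koszul_ker1 S' A' B' = f ` koszul_ker1 S A B"
    using eq0 mem f0 by (auto simp: koszul_ker1_def S' simp flip: int)
  moreover have "koszul_ker1 S A B \<subseteq> S" "f ` {0} = {0}" using f0 by (auto simp: koszul_ker1_def)
  ultimately have 1: "koszul_ker1 S' A' B' = {0} \<longleftrightarrow> koszul_ker1 S A B = {0}"
    using inj_on_image_eq_iff[OF inj, of "koszul_ker1 S A B" "{0}"] S(1) by auto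
  have "koszul_ran1 S' A' B' = ?ff ` koszul_ran1 S A B"
    by (auto simp: koszul_ran1_def S' image_iff simp flip: int)
  moreover have "koszul_ker2 S' A' B' = ?ff ` koszul_ker2 S A B"
  proof -
    have "A' (f y) - B' (f x) = 0 \<longleftrightarrow> A y - B x = 0" if "x \<in> S" "y \<in> S" for x y
      using that eq0[of "A y - B x"] S mem f(2)[of "A y" "B x"] int by simp
    then show ?thesis by (auto simp: koszul_ker2_def S' image_iff)
  qed
  moreover have "koszul_ran1 S A B \<subseteq> S \<times> S" "koszul_ker2 S A B \<subseteq> S \<times> S"
    using mem by (auto simp: koszul_ran1_def koszul_ker2_def)
  ultimately have 2: "koszul_ran1 S' A' B' = koszul_ker2 S' A' B' \<longleftrightarrow>
      koszul_ran1 S A B = koszul_ker2 S A B"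
    using inj_on_image_eq_iff[OF injff] by simp
  have "koszul_ran2 S' A' B' = f ` koszul_ran2 S A B"
  proof -
    have "A' (f y) - B' (f x) = f (A y - B x)" if "x \<in> S" "y \<in> S" for x y
      using that mem f(2)[of "A y" "B x"] int by simp
    then show ?thesis
      unfolding koszul_ran2_def S' by (auto simp: image_iff) (metis+)
  qed
  moreover have "koszul_ran2 S A B \<subseteq> S"
    using S mem by (auto simp: koszul_ran2_def)
  ultimately have 3: "koszul_ran2 S' A' B' = S' \<longleftrightarrow> koszul_ran2 S A B = S"
    using inj_on_image_eq_iff[OF inj, of "koszul_ran2 S A B" S] S' by auto
  show ?thesis by (simp add: koszul_exact_def 1 2 3)
qed

subsection \<open>Approximate joint eigenvectors of the adjoints\<close>

text \<open>Says that \<open>(cnj l1, cnj l2)\<close> is in the joint approximate point spectrum of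
\<open>(T1\<^sup>*, T2\<^sup>*)\<close>, with approximate eigenvectors in \<open>K\<close>, without mentioning adjoints.\<close>
definition approx_left_eigen ::
  "'a::complex_inner set \<Rightarrow> ('a \<Rightarrow> 'a) \<Rightarrow> ('a \<Rightarrow> 'a) \<Rightarrow> complex \<Rightarrow> complex \<Rightarrow> bool" where
  "approx_left_eigen K T1 T2 l1 l2 \<longleftrightarrow> (\<forall>\<epsilon>>0. \<exists>u\<in>K. u \<noteq> 0 \<and>
     (\<forall>x. cmod (cinner (T1 x - scaleC l1 x) u) \<le> \<epsilon> * norm x * norm u) \<and>
     (\<forall>x. cmod (cinner (T2 x - scaleC l2 x) u) \<le> \<epsilon> * norm x * norm u))"

lemma approx_left_eigen_swap: "approx_left_eigen K T1 T2 l1 l2 \<Longrightarrow> approx_left_eigen K T2 T1 l2 l1"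
  unfolding approx_left_eigen_def by blast

text \<open>Rescale the approximate eigenvectors so that both error bounds become
  \<open>norm x\<close>. If the last map were onto, each \<open>g\<close> would have pairings with
  them bounded by \<open>norm h2 + norm h1\<close>, so by uniform boundedness their norms would be
  bounded; but smaller errors make the rescaled vectors arbitrarily long. Equality is asked only
  against \<open>K\<close>, so \<open>g\<close> matters only modulo the orthogonal complement of
  \<open>K\<close>.\<close>

lemma approx_left_eigen_not_onto:
  fixes K :: "'a::chilbert set"
  assumes K: "closed_csubspace K" and ap: "approx_left_eigen K T1 T2 l1 l2"
  shows "\<not> (\<forall>g. \<exists>h1 h2. \<forall>u\<in>K.
    cinner g u = cinner ((T1 h2 - scaleC l1 h2) - (T2 h1 - scaleC l2 h1)) u)"
proof
  assume onto: "\<forall>g. \<exists>h1 h2. \<forall>u\<in>K.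
    cinner g u = cinner ((T1 h2 - scaleC l1 h2) - (T2 h1 - scaleC l2 h1)) u"
  define B where "B = {u\<in>K. (\<forall>x. cmod (cinner (T1 x - scaleC l1 x) u) \<le> norm x) \<and>
     (\<forall>x. cmod (cinner (T2 x - scaleC l2 x) u) \<le> norm x)}"
  have "\<exists>M. \<forall>u\<in>B. cmod (cinner g u) \<le> M" for g
  proof -
    obtain h1 h2 where h: "\<forall>u\<in>K.
        cinner g u = cinner ((T1 h2 - scaleC l1 h2) - (T2 h1 - scaleC l2 h1)) u"
      using onto by blast
    have "cmod (cinner g u) \<le> norm h2 + norm h1" if u: "u \<in> B" for u
    proof -
      have "cinner g u = cinner (T1 h2 - scaleC l1 h2) u - cinner (T2 h1 - scaleC l2 h1) u"
        using h u by (simp add: B_def cinner_diff_left)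
      also have "cmod \<dots> \<le> cmod (cinner (T1 h2 - scaleC l1 h2) u) + cmod (cinner (T2 h1 - scaleC l2 h1) u)"
        by (rule norm_triangle_ineq4)
      also have "\<dots> \<le> norm h2 + norm h1" using u by (intro add_mono) (auto simp: B_def)
      finally show ?thesis .
    qed
    then show ?thesis by blast
  qed
  then obtain M where M: "\<And>u. u \<in> B \<Longrightarrow> norm u \<le> M"
    using pointwise_bounded_imp_norm_bounded[of B] by blast
  \<comment> \<open>Chosen so that the rescaled vector has norm
    \<open>1 / \<epsilon> = \<bar>M\<bar> + 1\<close>, beyond the bound \<open>M\<close>.\<close>
  define \<epsilon> where "\<epsilon> = 1 / (\<bar>M\<bar> + 1)"
  have eps: "\<epsilon> > 0" by (simp add: \<epsilon>_def add_nonneg_pos)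
  obtain u where u: "u \<in> K" "u \<noteq> 0"
    "\<And>x. cmod (cinner (T1 x - scaleC l1 x) u) \<le> \<epsilon> * norm x * norm u"
    "\<And>x. cmod (cinner (T2 x - scaleC l2 x) u) \<le> \<epsilon> * norm x * norm u"
    using ap eps unfolding approx_left_eigen_def by blast
  define t where "t = 1 / (\<epsilon> * norm u)"
  have t: "t > 0" using eps u(2) by (simp add: t_def)
  have te: "t * (\<epsilon> * norm x * norm u) = norm x" for x :: 'a
    using eps u(2) by (simp add: t_def)
  have "scaleC (complex_of_real t) u \<in> B"
    unfolding B_def
  proof (intro CollectI conjI allI)
    show "scaleC (complex_of_real t) u \<in> K" using K u(1) by (rule csubspace_scaleC)
    fix x
    show "cmod (cinner (T1 x - scaleC l1 x) (scaleC (complex_of_real t) u)) \<le> norm x"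
      using mult_left_mono[OF u(3)[of x], of t] t te
      by (simp add: cinner_scaleC_right norm_mult)
    show "cmod (cinner (T2 x - scaleC l2 x) (scaleC (complex_of_real t) u)) \<le> norm x"
      using mult_left_mono[OF u(4)[of x], of t] t te
      by (simp add: cinner_scaleC_right norm_mult)
  qed
  then have "t * norm u \<le> M" using M t by (force simp: norm_scaleC)
  moreover have "t * norm u = \<bar>M\<bar> + 1" using u(2) by (simp add: t_def \<epsilon>_def)
  ultimately show False by simp
qed

text \<open>Moving \<open>r * l2\<close> to \<open>l2\<close> costs at most
  \<open>(1 - r) * cmod l2\<close> in the second estimate. This reaches \<open>cmod l2 = 1\<close>,
  where the resolvent construction below breaks down.\<close>

lemma approx_left_eigen_limit:
  assumes "\<And>r. 0 < r \<Longrightarrow> r < 1 \<Longrightarrow> approx_left_eigen K T1 T2 l1 (complex_of_real r * l2)"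
    and l2: "cmod l2 \<le> 1"
  shows "approx_left_eigen K T1 T2 l1 l2"
  unfolding approx_left_eigen_def
proof (intro allI impI)
  fix \<epsilon> :: real assume eps: "\<epsilon> > 0"
  \<comment> \<open>The second entry leaves half of \<open>\<epsilon>\<close> for the change of
    eigenvalue; the first keeps \<open>r\<close> positive.\<close>
  define r where "r = max (1/2) (1 - \<epsilon> / 2)"
  have r: "0 < r" "r < 1" "1 - r \<le> \<epsilon> / 2" using eps by (auto simp: r_def max_def)
  obtain u where u: "u \<in> K" "u \<noteq> 0"
    "\<And>x. cmod (cinner (T1 x - scaleC l1 x) u) \<le> \<epsilon> / 2 * norm x * norm u"
    "\<And>x. cmod (cinner (T2 x - scaleC (complex_of_real r * l2) x) u) \<le> \<epsilon> / 2 * norm x * norm u"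
    using assms(1)[OF r(1,2)] eps unfolding approx_left_eigen_def
    by (meson half_gt_zero)
  have "cmod (cinner (T2 x - scaleC l2 x) u) \<le> \<epsilon> * norm x * norm u" for x
  proof -
    have "T2 x - scaleC l2 x = (T2 x - scaleC (complex_of_real r * l2) x)
        - scaleC (complex_of_real (1 - r) * l2) x"
      by (simp add: algebra_simps scaleC_diff_left)
    then have "cmod (cinner (T2 x - scaleC l2 x) u)
        \<le> cmod (cinner (T2 x - scaleC (complex_of_real r * l2) x) u)
          + cmod (cinner (scaleC (complex_of_real (1 - r) * l2) x) u)"
      by (metis cinner_diff_left norm_triangle_ineq4)
    moreover have "cmod (cinner (scaleC (complex_of_real (1 - r) * l2) x) u)
        \<le> (1 - r) * cmod l2 * norm x * norm u"
      using cinner_Cauchy_Schwarz[of "scaleC (complex_of_real (1 - r) * l2) x" u] r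
      by (simp add: norm_scaleC norm_mult del: of_real_diff)
    moreover have "(1 - r) * cmod l2 * norm x * norm u \<le> (\<epsilon> / 2) * 1 * norm x * norm u"
      using r l2 by (intro mult_mono) auto
    ultimately show ?thesis using u(4)[of x] by simp
  qed
  moreover have "\<epsilon> / 2 * norm x * norm u \<le> \<epsilon> * norm x * norm u" for x :: 'a
    using eps by (intro mult_right_mono) auto
  ultimately show "\<exists>u\<in>K. u \<noteq> 0 \<and>
      (\<forall>x. cmod (cinner (T1 x - scaleC l1 x) u) \<le> \<epsilon> * norm x * norm u) \<and>
      (\<forall>x. cmod (cinner (T2 x - scaleC l2 x) u) \<le> \<epsilon> * norm x * norm u)"
    using u order_trans by blast
qed

lemma norm_sum_orthogonal:
  assumes orth: "\<And>m k. cinner (w m) (w k) = (if m = k then complex_of_real c else 0)"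
    and l: "cmod l = 1"
  shows "(norm (\<Sum>m<N. scaleC (l ^ m) (w m :: 'a::complex_inner)))\<^sup>2 = real N * c"
proof (induction N)
  case (Suc N)
  have "cinner (\<Sum>m<N. scaleC (l ^ m) (w m)) (scaleC (l ^ N) (w N)) = 0"
    by (simp add: cinner_sum_left cinner_scaleC_left cinner_scaleC_right orth)
  moreover have "(norm (w N))\<^sup>2 = c" using orth[of N N] by (simp add: cinner_self del: of_real_power)
  ultimately show ?case
    using Suc unfolding sum.lessThan_Suc norm_add_sq
    by (simp add: norm_scaleC norm_power l algebra_simps)
qed simp

text \<open>The adjoint of \<open>T\<close> shifts the sequence \<open>w\<close>, so that
\<open>(T\<^sup>* - cnj l) (\<Sum>m<N. l ^ m w m)\<close> telescopes to the two boundary terms, of bounded norm.\<close>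
lemma shift_approx_left_eigen:
  fixes w :: "nat \<Rightarrow> 'a::complex_inner"
  assumes orth: "\<And>m k. cinner (w m) (w k) = (if m = k then complex_of_real c else 0)"
    and c: "c > 0" and shift: "\<And>m x. cinner (T x) (w m) = cinner x (w (Suc m))"
    and l: "cmod l = 1" and eps: "\<epsilon> > 0"
  obtains N where "(\<Sum>m<N. scaleC (l ^ m) (w m)) \<noteq> 0"
    and "\<And>x. cmod (cinner (T x - scaleC l x) (\<Sum>m<N. scaleC (l ^ m) (w m)))
      \<le> \<epsilon> * norm x * norm (\<Sum>m<N. scaleC (l ^ m) (w m))"
proof -
  \<comment> \<open>The two boundary terms contribute at most \<open>2 * sqrt c * norm x\<close>,
    while \<open>norm u\<close> is \<open>sqrt (N * c)\<close>.\<close>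
  obtain N where N: "real N > (2 / \<epsilon>)\<^sup>2" using reals_Archimedean2 by blast
  define u where "u = (\<Sum>m<N. scaleC (l ^ m) (w m))"
  have nu: "(norm u)\<^sup>2 = real N * c"
    unfolding u_def by (rule norm_sum_orthogonal[OF orth l])
  have nw: "norm (w m) = sqrt c" for m
  proof -
    have "(norm (w m))\<^sup>2 = c" using orth[of m m] by (simp add: cinner_self del: of_real_power)
    then show ?thesis by (metis norm_ge_zero real_sqrt_unique)
  qed
  have "2 * sqrt c \<le> \<epsilon> * norm u"
  proof (rule power2_le_imp_le)
    have "(2 / \<epsilon>)\<^sup>2 * c \<le> real N * c" using N c by (intro mult_right_mono) auto
    then show "(2 * sqrt c)\<^sup>2 \<le> (\<epsilon> * norm u)\<^sup>2"
      using eps c by (simp add: power_mult_distrib nu power_divide field_simps)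
  qed (use eps in auto)
  note le = this
  have "u \<noteq> 0" using le c by auto
  moreover have "cmod (cinner (T x - scaleC l x) u) \<le> \<epsilon> * norm x * norm u" for x
  proof -
    \<comment> \<open>This is the contribution of \<open>scaleC l x\<close> to the
      \<open>m\<close>-th term. Since \<open>cnj l * l = 1\<close>, the contribution of
      \<open>T x\<close> is the same expression at \<open>Suc m\<close>.\<close>
    define t where "t m = cnj l * l ^ m * cinner x (w m)" for m
    have cl: "cnj l * l = 1"
      using l by (simp add: complex_norm_square[symmetric] mult.commute flip: of_real_power)
    have tS: "t (Suc m) = l ^ m * cinner x (w (Suc m))" for m
      by (simp add: t_def cl flip: mult.assoc)
    have "cinner (T x - scaleC l x) u = (\<Sum>m<N. l ^ m * cinner x (w (Suc m)) - t m)"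
      by (simp add: u_def cinner_sum_right cinner_scaleC_right cinner_diff_left
          cinner_scaleC_left shift t_def right_diff_distrib mult.left_commute mult.assoc)
    also have "\<dots> = (\<Sum>m<N. t (Suc m) - t m)" by (simp only: tS)
    also have "\<dots> = t N - t 0" by (rule sum_lessThan_telescope)
    also have "cmod \<dots> \<le> cmod (t N) + cmod (t 0)" by (rule norm_triangle_ineq4)
    also have "\<dots> \<le> norm x * sqrt c + norm x * sqrt c"
      using cinner_Cauchy_Schwarz[of x "w N"] cinner_Cauchy_Schwarz[of x "w 0"]
      by (intro add_mono) (simp_all add: t_def norm_mult norm_power l nw)
    also have "\<dots> \<le> norm x * (\<epsilon> * norm u)"
      using mult_left_mono[OF le norm_ge_zero[of x]] by (simp add: mult_ac)
    finally show ?thesis by (simp add: mult_ac)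
  qed
  ultimately show ?thesis using that unfolding u_def by blast
qed

text \<open>The adjoint of \<open>V1\<close> shifts \<open>a\<close> forward, and the adjoint of
  \<open>V2\<close> kills \<open>a (Suc m)\<close>. Applying the inverse of
  \<open>1 - cnj l2 V2\<close> to \<open>a (Suc m)\<close> gives exact eigenvectors
  \<open>w m\<close> of the adjoint of \<open>V2\<close> for \<open>cnj l2\<close>, still orthogonal
  and still shifted by the adjoint of \<open>V1\<close>; their truncated sums handle
  \<open>l1\<close>.\<close>

lemma approx_left_eigen_isometries:
  fixes V1 V2 :: "'a::chilbert \<Rightarrow> 'a"
  assumes V: "isometry_op V1" "isometry_op V2" "\<And>x. V1 (V2 x) = V2 (V1 x)"
    and K: "closed_csubspace K" "V1 ` K \<subseteq> K" "V2 ` K \<subseteq> K"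
    and a: "\<And>m. a m \<in> K" "\<And>m k. cinner (a m) (a k) = (if m = k then complex_of_real c else 0)"
      "c > 0" "\<And>m. V1 (a (Suc m)) = a m" "\<And>m x. cinner (V2 x) (a (Suc m)) = 0"
    and l: "cmod l1 = 1" "cmod l2 \<le> 1"
  shows "approx_left_eigen K V1 V2 l1 l2"
proof -
  note lin = isometry_clinear[OF V(1)] isometry_clinear[OF V(2)]
  have "approx_left_eigen K V1 V2 l1 l2" if l2: "cmod l2 < 1" for l2
  proof -
    have ex1: "\<exists>!w\<in>K. w = b + scaleC (cnj l2) (V2 w)" if "b \<in> K" for b
      using contraction_resolvent[OF K(1,3) lin(2) _ _ that, of "cnj l2"] l2 isometry_norm[OF V(2)]
      by simp
    \<comment> \<open>The index starts at \<open>Suc m\<close> because \<open>a 0\<close> need not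
      be orthogonal to the range of \<open>V2\<close>.\<close>
    then have "\<forall>m. \<exists>w\<in>K. w = a (Suc m) + scaleC (cnj l2) (V2 w)" using a(1) by blast
    then obtain w where w: "\<And>m. w m \<in> K" "\<And>m. w m = a (Suc m) + scaleC (cnj l2) (V2 (w m))"
      by metis
    \<comment> \<open>\<open>V1\<close> commutes with \<open>V2\<close>, so the left-hand side
      solves the equation that defines \<open>w m\<close>.\<close>
    have V1w: "V1 (w (Suc m)) = w m" for m
    proof -
      have "V1 (w (Suc m)) = a (Suc m) + scaleC (cnj l2) (V2 (V1 (w (Suc m))))"
        using arg_cong[OF w(2)[of "Suc m"], of V1] by (simp add: clinear_simps lin a V(3))
      moreover have "V1 (w (Suc m)) \<in> K" using w K by blast
      ultimately show ?thesis using ex1[OF a(1)[of "Suc m"]] w by metis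
    qed
    have V2w: "cinner (V2 x) (w m) = cnj l2 * cinner x (w m)" for x m
      by (subst w(2)) (simp add: cinner_add_right cinner_scaleC_right a isometry_cinner[OF V(2)])
    define d where "d = c / (1 - (cmod l2)\<^sup>2)"
    have pos: "1 - (cmod l2)\<^sup>2 > 0" using l2 by (simp add: power_less_one_iff abs_square_less_1)
    have orth: "cinner (w m) (w k) = (if m = k then complex_of_real d else 0)" for m k
    proof -
      have "cinner (w m) (w k) = cinner (a (Suc m)) (w k) + l2 * cinner (V2 (w m)) (w k)"
        by (subst w(2)[of m]) (simp add: cinner_add_left cinner_scaleC_left)
      also have "cinner (V2 (w m)) (w k) = cnj l2 * cinner (w m) (w k)" by (rule V2w)
      also have "cinner (a (Suc m)) (w k)
          = cinner (a (Suc m)) (a (Suc k)) + cnj l2 * cinner (a (Suc m)) (V2 (w k))"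
        by (subst w(2)[of k]) (simp add: cinner_add_right cinner_scaleC_right)
      also have "cinner (a (Suc m)) (V2 (w k)) = 0"
        using a(5)[of "w k" m] by (metis cinner_commute complex_cnj_zero)
      finally have "cinner (w m) (w k) * (1 - l2 * cnj l2) = (if m = k then complex_of_real c else 0)"
        by (simp add: a(2) algebra_simps)
      moreover have "1 - l2 * cnj l2 = complex_of_real (1 - (cmod l2)\<^sup>2)"
        by (simp add: complex_norm_square[symmetric] flip: of_real_power)
      ultimately show ?thesis
        using pos by (auto simp: d_def nonzero_eq_divide_eq simp del: of_real_diff of_real_power split: if_splits)
    qed
    show ?thesis
      unfolding approx_left_eigen_def
    proof (intro allI impI)
      fix \<epsilon> :: real assume eps: "\<epsilon> > 0"
      have d: "d > 0" using pos a(3) by (simp add: d_def)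
      have shift: "cinner (V1 x) (w m) = cinner x (w (Suc m))" for x m
        by (metis V1w isometry_cinner[OF V(1)])
      obtain N where N: "(\<Sum>m<N. scaleC (l1 ^ m) (w m)) \<noteq> 0"
        "\<And>x. cmod (cinner (V1 x - scaleC l1 x) (\<Sum>m<N. scaleC (l1 ^ m) (w m)))
          \<le> \<epsilon> * norm x * norm (\<Sum>m<N. scaleC (l1 ^ m) (w m))"
        using shift_approx_left_eigen[OF orth d shift l(1) eps] by blast
      have "cinner (V2 x - scaleC l2 x) (\<Sum>m<N. scaleC (l1 ^ m) (w m)) = 0" for x
        by (simp add: cinner_sum_right cinner_scaleC_right cinner_diff_left cinner_scaleC_left V2w)
      moreover have "(\<Sum>m<N. scaleC (l1 ^ m) (w m)) \<in> K"
        using K(1) w(1) by (intro csubspace_sum csubspace_scaleC)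
      ultimately show "\<exists>u\<in>K. u \<noteq> 0 \<and>
          (\<forall>x. cmod (cinner (V1 x - scaleC l1 x) u) \<le> \<epsilon> * norm x * norm u) \<and>
          (\<forall>x. cmod (cinner (V2 x - scaleC l2 x) u) \<le> \<epsilon> * norm x * norm u)"
        using N eps by (intro bexI[of _ "\<Sum>m<N. scaleC (l1 ^ m) (w m)"]) auto
    qed
  qed
  note strict = this
  show ?thesis
  proof (rule approx_left_eigen_limit[OF strict l(2)])
    fix r :: real assume r: "0 < r" "r < 1"
    have "r * cmod l2 \<le> r" using l(2) r by (intro mult_left_le) auto
    then have "r * cmod l2 < 1" using r by linarith
    then show "cmod (complex_of_real r * l2) < 1" using r by (simp add: norm_mult)
  qed
qed

subsection \<open>Adjoints of unitaries, projections\<close>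

lemma adj_eqI:
  assumes "\<And>x y. cinner (T x) y = cinner x (S y)" shows "adj T = S"
  unfolding adj_def using assms by (intro the_equality ext) (auto intro: cinner_eqI_left)

lemma unitary_isometry: "unitary_op U \<Longrightarrow> isometry_op U"
  by (simp add: unitary_op_def)

lemma adj_unitary:
  assumes "unitary_op U"
  shows "adj U (U x) = x" and "U (adj U x) = x"
    and "cinner (U x) y = cinner x (adj U y)" and "cinner (adj U x) y = cinner x (U y)"
    and "isometry_op (adj U)"
proof -
  have iso: "isometry_op U" and surj: "surj U" using assms by (auto simp: unitary_op_def)
  note lin = isometry_clinear[OF iso]
  have inj: "inj U"
  proof (rule injI)
    fix x y assume "U x = U y"
    then have "norm (x - y) = 0"
      using isometry_norm[OF iso, of "x - y"] by (simp add: clinear_diff[OF lin])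
    then show "x = y" by simp
  qed
  have adj: "adj U = inv U"
    by (rule adj_eqI) (metis surj surj_f_inv_f isometry_cinner[OF iso])
  show 1: "adj U (U x) = x" and 2: "U (adj U x) = x" for x
    by (simp_all add: adj inj surj surj_f_inv_f)
  show "cinner (U x) y = cinner x (adj U y)"
    by (metis 2 isometry_cinner[OF iso])
  show "cinner (adj U x) y = cinner x (U y)"
    by (metis 2 isometry_cinner[OF iso])
  have norm: "norm (adj U x) = norm x" for x
    by (metis 2 isometry_norm[OF iso])
  have "clinear_on UNIV (adj U)"
    unfolding clinear_on_def by (metis 1 2 clinear_add[OF lin] clinear_scaleC[OF lin])
  then show "isometry_op (adj U)"
    unfolding isometry_op_def bounded_clinear_op_def using norm by (auto intro!: exI[of _ 1])
qed

lemma orth_projection_clinear: "orth_projection P \<Longrightarrow> clinear_on UNIV P"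
  and orth_projection_idem: "orth_projection P \<Longrightarrow> P (P x) = P x"
  and orth_projection_selfadj: "orth_projection P \<Longrightarrow> cinner (P x) y = cinner x (P y)"
  by (auto simp: orth_projection_def bounded_clinear_op_def)

text \<open>One Pythagorean estimate for both fibre operators (coefficients 1 and \<open>z\<close>)
  and for \<open>P\<close> and its complement (coefficients 0 and 1).\<close>

lemma orth_projection_mix_norm:
  assumes P: "orth_projection P" and "cmod a \<le> 1" "cmod b \<le> 1"
  shows "norm (scaleC a (x - P x) + scaleC b (P x)) \<le> norm x"
proof (rule power2_le_imp_le)
  have orth: "cinner (x - P x) (P x) = 0"
    by (simp add: cinner_diff_left orth_projection_selfadj[OF P] orth_projection_idem[OF P])
  have "(norm (scaleC a (x - P x) + scaleC b (P x)))\<^sup>2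
      = (cmod a)\<^sup>2 * (norm (x - P x))\<^sup>2 + (cmod b)\<^sup>2 * (norm (P x))\<^sup>2"
    unfolding norm_add_sq
    by (simp add: cinner_scaleC_left cinner_scaleC_right orth norm_scaleC power_mult_distrib)
  also have "\<dots> \<le> 1 * (norm (x - P x))\<^sup>2 + 1 * (norm (P x))\<^sup>2"
    using assms by (intro add_mono mult_right_mono) (auto simp: power_le_one)
  also have "\<dots> = (norm x)\<^sup>2"
    using norm_add_sq[of "x - P x" "P x"] orth by simp
  finally show "(norm (scaleC a (x - P x) + scaleC b (P x)))\<^sup>2 \<le> (norm x)\<^sup>2" .
qed simp

lemma cinner_funpow_isometry:
  assumes V: "isometry_op V" and orth: "\<And>j. cinner e ((V ^^ Suc j) e) = 0"
  shows "cinner ((V ^^ m) e) ((V ^^ k) e) = (if m = k then complex_of_real ((norm e)\<^sup>2) else 0)"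
proof -
  have shift: "cinner ((V ^^ m) x) ((V ^^ m) y) = cinner x y" for m x y
    by (induction m) (simp_all add: isometry_cinner[OF V])
  have less: "cinner ((V ^^ m) e) ((V ^^ k) e) = 0" if mk: "m < k" for m k
  proof -
    obtain j where "k = m + Suc j" using less_imp_Suc_add[OF mk] by auto
    then have "(V ^^ k) e = (V ^^ m) ((V ^^ Suc j) e)" by (simp only: funpow_add comp_apply)
    then show ?thesis by (simp only: shift orth)
  qed
  consider "m = k" | "m < k" | "k < m" by linarith
  then show ?thesis
  proof cases
    case 1 then show ?thesis using cinner_self[of e] by (simp add: shift)
  next
    case 2 then show ?thesis by (simp add: less)
  next
    case 3 then show ?thesis using less[OF 3] by (subst cinner_commute) simp
  qed
qed

section \<open>Exactness outside the closed bidisc, and failure from approximate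
  eigenvectors\<close>

lemma additive_endo_minus_scalar:
  assumes "closed_csubspace K" "T ` K \<subseteq> K" "clinear_on UNIV T"
  shows "additive_endo K (\<lambda>x. T x - scaleC l x)"
  unfolding additive_endo_def using assms
  by (auto intro!: csubspace_diff csubspace_scaleC simp: clinear_simps scaleC_add_right)

lemma koszul_exact_outside_bidisc:
  fixes T1 T2 :: "'a::chilbert \<Rightarrow> 'a"
  assumes K: "closed_csubspace K" "T1 ` K \<subseteq> K" "T2 ` K \<subseteq> K"
    and lin: "clinear_on UNIV T1" "clinear_on UNIV T2"
    and contr: "\<And>x. norm (T1 x) \<le> norm x" "\<And>x. norm (T2 x) \<le> norm x"
    and comm: "\<And>x. T1 (T2 x) = T2 (T1 x)"
    and l: "cmod l1 > 1 \<or> cmod l2 > 1"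
  shows "koszul_exact K (\<lambda>x. T1 x - scaleC l1 x) (\<lambda>x. T2 x - scaleC l2 x)"
proof (rule koszul_exact_if_bij)
  show "bij_betw (\<lambda>x. T1 x - scaleC l1 x) K K \<or> bij_betw (\<lambda>x. T2 x - scaleC l2 x) K K"
    using contraction_minus_scalar_bij[OF K(1,2) lin(1) contr(1)]
      contraction_minus_scalar_bij[OF K(1,3) lin(2) contr(2)] l by blast
  show "T1 (T2 x - scaleC l2 x) - scaleC l1 (T2 x - scaleC l2 x)
      = T2 (T1 x - scaleC l1 x) - scaleC l2 (T1 x - scaleC l1 x)" for x
    by (simp add: clinear_simps lin comm scaleC_diff_right scaleC_scaleC mult.commute)
qed (use K lin in \<open>auto intro: csubspace_zero csubspace_add csubspace_minus additive_endo_minus_scalar\<close>)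

text \<open>Uniform boundedness needs every \<open>g\<close> of the ambient space, whereas exactness
  speaks only of \<open>S\<close>. So \<open>g\<close> is replaced by its component in
  \<open>K\<close>, which lies in \<open>S\<close> and has the same pairings with
  \<open>K\<close>.\<close>

lemma approx_left_eigen_not_exact:
  fixes K :: "'a::chilbert set"
  assumes "closed_csubspace K" "approx_left_eigen K T1 T2 l1 l2"
    and proj: "\<And>g. \<exists>p\<in>K. \<forall>u\<in>K. cinner g u = cinner p u" and "K \<subseteq> S"
  shows "\<not> koszul_exact S (\<lambda>x. T1 x - scaleC l1 x) (\<lambda>x. T2 x - scaleC l2 x)"
proof
  assume ex: "koszul_exact S (\<lambda>x. T1 x - scaleC l1 x) (\<lambda>x. T2 x - scaleC l2 x)"
  have "\<exists>h1 h2. \<forall>u\<in>K. cinner g u = cinner ((T1 h2 - scaleC l1 h2) - (T2 h1 - scaleC l2 h1)) u" for g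
  proof -
    obtain p where p: "p \<in> K" "\<forall>u\<in>K. cinner g u = cinner p u" using proj by blast
    then have "p \<in> koszul_ran2 S (\<lambda>x. T1 x - scaleC l1 x) (\<lambda>x. T2 x - scaleC l2 x)"
      using ex assms(4) by (auto simp: koszul_exact_def)
    then show ?thesis using p by (auto simp: koszul_ran2_def)
  qed
  then show False using approx_left_eigen_not_onto[OF assms(1,2)] by blast
qed

subsection \<open>The spectrum of the fibres\<close>

text \<open>The vectors \<open>adj U ^^ n e\<close> (\<open>n \<ge> 0\<close>) and \<open>U ^^ n e\<close> (\<open>n > 0\<close>) form a bilateral orthogonal
sequence on which \<open>adj U\<close> acts as the shift; \<open>P\<close> is the projection onto its nonnegative half.\<close>
locale negative_bcl_triple =
  fixes P U :: "'e::chilbert \<Rightarrow> 'e" and e :: 'e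
  assumes P: "orth_projection P" and U: "unitary_op U"
    and kerP: "\<And>a. P a = 0 \<Longrightarrow> P (U a) = 0"
    and e: "e \<noteq> 0" "P e = e" "P (U e) = 0"
begin

lemmas lin_simps = clinear_simps[OF orth_projection_clinear[OF P]]
  clinear_simps[OF isometry_clinear[OF unitary_isometry[OF U]]]
  clinear_simps[OF isometry_clinear[OF adj_unitary(5)[OF U]]]
  orth_projection_idem[OF P] adj_unitary(1,2)[OF U]
  scaleC_add_right scaleC_diff_right scaleC_scaleC

text \<open>The adjoint form of \<open>kerP\<close>: since \<open>U\<close> preserves the kernel of
  \<open>P\<close>, its adjoint preserves the orthogonal complement, the range of
  \<open>P\<close>.\<close>

lemma ranP: assumes "P x = x" shows "P (adj U x) = adj U x"
proof -
  have "cinner y (adj U x - P (adj U x)) = 0" for y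
  proof -
    have "cinner y (adj U x - P (adj U x)) = cinner (y - P y) (adj U x)"
      by (simp add: cinner_diff_left cinner_diff_right orth_projection_selfadj[OF P])
    also have "\<dots> = cinner (U (y - P y)) (P x)" using assms by (simp add: adj_unitary(3)[OF U])
    also have "\<dots> = cinner (P (U (y - P y))) x" by (simp add: orth_projection_selfadj[OF P])
    also have "P (U (y - P y)) = 0" by (rule kerP) (simp add: lin_simps)
    finally show ?thesis by simp
  qed
  then show ?thesis using cinner_eqI_left[of "adj U x - P (adj U x)" 0] by simp
qed

lemma P_U_funpow: "P ((U ^^ Suc m) e) = 0"
  by (induction m) (use e kerP in auto)

lemma P_adj_funpow: "P ((adj U ^^ m) e) = (adj U ^^ m) e"
  by (induction m) (use e ranP in auto)

lemma orth_U: "cinner e ((U ^^ Suc m) e) = 0"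
  using P_U_funpow[of m] e(2) by (metis cinner_zero_right orth_projection_selfadj[OF P])

lemma orth_adj: "cinner e ((adj U ^^ Suc m) e) = 0"
proof -
  have "cinner x ((adj U ^^ k) y) = cinner ((U ^^ k) x) y" for k x y
    by (induction k arbitrary: x y) (simp_all add: adj_unitary(3)[OF U, symmetric] funpow_swap1)
  then show ?thesis using orth_U[of m] by (metis cinner_commute complex_cnj_zero)
qed

lemmas cinner_U_funpow = cinner_funpow_isometry[OF unitary_isometry[OF U] orth_U]
lemmas cinner_adj_funpow = cinner_funpow_isometry[OF adj_unitary(5)[OF U] orth_adj]

lemma clinear_phi: "clinear_on UNIV (phi1 P U z)" "clinear_on UNIV (phi2 P U z)"
  unfolding clinear_on_def phi1_def phi2_def by (auto simp: lin_simps algebra_simps)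

lemma phi1_contraction: "cmod z \<le> 1 \<Longrightarrow> norm (phi1 P U z x) \<le> norm x"
  using orth_projection_mix_norm[OF P, of 1 z x]
  by (simp add: phi1_def isometry_norm[OF adj_unitary(5)[OF U]] scaleC_one)

lemma phi2_contraction: "cmod z \<le> 1 \<Longrightarrow> norm (phi2 P U z x) \<le> norm x"
  using orth_projection_mix_norm[OF P, of z 1 "U x"]
  by (simp add: phi2_def isometry_norm[OF unitary_isometry[OF U]] scaleC_one add.commute)

lemma phi1_phi2: "phi1 P U z (phi2 P U z x) = scaleC z x"
  and phi2_phi1: "phi2 P U z (phi1 P U z x) = scaleC z x"
  by (simp_all add: phi1_def phi2_def lin_simps)

text \<open>The joint eigenvector is \<open>(\<Sum>n\<ge>0. l2 ^ n (adj U ^^ n e)) + (\<Sum>n\<ge>1. l1 ^ n (U ^^ n e))\<close>;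
the two Neumann series are \<open>p\<close> and \<open>l1 q\<close> below.\<close>
lemma joint_eigenvalue_phi:
  assumes l: "cmod l1 < 1" "cmod l2 < 1"
  shows "joint_eigenvalue (phi1 P U (l1 * l2)) (phi2 P U (l1 * l2)) (l1, l2)"
proof -
  note lin = isometry_clinear[OF unitary_isometry[OF U]] isometry_clinear[OF adj_unitary(5)[OF U]]
  note norm = isometry_norm[OF unitary_isometry[OF U]] isometry_norm[OF adj_unitary(5)[OF U]]
  obtain p where p: "p = e + scaleC l2 (adj U p)"
    using contraction_resolvent[OF closed_csubspace_UNIV _ lin(2) _ l(2), of e] norm by auto
  obtain q where q: "q = U e + scaleC l1 (U q)"
    using contraction_resolvent[OF closed_csubspace_UNIV _ lin(1) _ l(1), of "U e"] norm by auto
  \<comment> \<open>As \<open>p\<close> and \<open>q\<close> are fixed points rather than explicit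
    sums, their position relative to \<open>P\<close> is found by showing that the unwanted
    component is bounded by a strict multiple of itself.\<close>
  have zero: "x = 0" if "norm x \<le> cmod l * norm x" "cmod l < 1" for x :: 'e and l
  proof (rule ccontr)
    assume "x \<noteq> 0"
    then have "cmod l * norm x < 1 * norm x" using that by (intro mult_strict_right_mono) auto
    then show False using that by simp
  qed
  have Pp: "P p = p"
  proof -
    let ?r = "p - P p"
    have "P p = e + scaleC l2 (P (adj U p))"
      using arg_cong[OF p, of P] e by (simp add: lin_simps)
    then have "?r = scaleC l2 (adj U p - P (adj U p))"
      using p by (metis add_diff_cancel_left scaleC_diff_right)
    also have "adj U p - P (adj U p) = adj U ?r - P (adj U ?r)"
      using ranP[of "P p"] by (simp add: lin_simps)
    finally have "norm ?r = cmod l2 * norm (adj U ?r - P (adj U ?r))"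
      by (metis norm_scaleC)
    also have "norm (adj U ?r - P (adj U ?r)) \<le> norm ?r"
      using orth_projection_mix_norm[OF P, of 1 0 "adj U ?r"] norm(2)[of ?r] by (simp add: scaleC_one)
    finally have "?r = 0" using l(2) by (intro zero[of _ l2]) (auto simp: mult_left_mono)
    then show ?thesis by simp
  qed
  have Pq: "P q = 0"
  proof -
    have "P (U q) = P (U (P q))"
      using kerP[of "q - P q"] by (simp add: lin_simps)
    then have "P q = scaleC l1 (P (U (P q)))"
      using arg_cong[OF q, of P] e by (simp add: lin_simps)
    then have "norm (P q) = cmod l1 * norm (P (U (P q)))"
      by (metis norm_scaleC)
    also have "norm (P (U (P q))) \<le> norm (P q)"
      using orth_projection_mix_norm[OF P, of 0 1 "U (P q)"] norm(1)[of "P q"] by (simp add: scaleC_one)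
    finally show ?thesis using l(1) by (intro zero[of _ l1]) (auto simp: mult_left_mono)
  qed
  define x where "x = p + scaleC l1 q"
  have Px: "P x = p" by (simp add: x_def lin_simps Pp Pq)
  have "p \<noteq> 0" using p e(1) by (auto simp: lin_simps)
  then have "x \<noteq> 0" using Px by (auto simp: lin_simps)
  moreover have "phi1 P U (l1 * l2) x = scaleC l1 x"
  proof -
    have aq: "adj U q = e + scaleC l1 q"
      using arg_cong[OF q, of "adj U"] by (simp add: lin_simps)
    have ap: "scaleC l2 (adj U p) = p - e" using p by (simp add: algebra_simps)
    have "phi1 P U (l1 * l2) x = scaleC l1 (adj U q + scaleC l2 (adj U p))"
      by (simp add: phi1_def Px) (simp add: x_def lin_simps)
    also have "\<dots> = scaleC l1 x" by (simp add: aq ap x_def add.commute)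
    finally show ?thesis .
  qed
  moreover have "phi2 P U (l1 * l2) x = scaleC l2 x"
  proof -
    have Up: "U p = U e + scaleC l2 p"
      using arg_cong[OF p, of U] by (simp add: lin_simps)
    have Uq: "scaleC l1 (U q) = q - U e" using q by (simp add: algebra_simps)
    have Ux: "U x = scaleC l2 p + q" by (simp add: x_def lin_simps Up Uq)
    have PUx: "P (U x) = scaleC l2 p" by (simp add: Ux lin_simps Pp Pq)
    show ?thesis
      unfolding phi2_def PUx unfolding Ux
      by (simp add: x_def scaleC_add_right scaleC_scaleC mult.commute)
  qed
  ultimately show ?thesis unfolding joint_eigenvalue_def by auto
qed

text \<open>The adjoint of \<open>phi1\<close> acts as \<open>U\<close> on the half of the bilateral
  sequence in the kernel of \<open>P\<close>, and that of \<open>phi2\<close> acts as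
  \<open>adj U\<close> on the half in the range; in both cases the terms with \<open>z\<close>
  vanish. Whichever of \<open>l1\<close>, \<open>l2\<close> is unimodular decides which half is
  summed.\<close>

lemma approx_left_eigen_phi:
  assumes z: "cmod z < 1" "l1 * l2 = z" and l: "cmod l1 = 1 \<or> cmod l2 = 1"
  shows "approx_left_eigen UNIV (phi1 P U z) (phi2 P U z) l1 l2"
proof -
  text \<open>Since \<open>T T' = l l'\<close>, a bound for \<open>T - l\<close> on \<open>u\<close> gives one for \<open>T' - l'\<close>.\<close>
  have transfer: "\<forall>x. cmod (cinner (T' x - scaleC l' x) u) \<le> \<epsilon> * norm x * norm u"
    if T: "clinear_on UNIV T" "\<And>x. T (T' x) = scaleC (l * l') x" "\<And>x. norm (T' x) \<le> norm x"
      and l: "cmod l = 1" and eps: "\<epsilon> > 0"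
      and u: "\<And>x. cmod (cinner (T x - scaleC l x) u) \<le> \<epsilon> * norm x * norm u"
    for T T' :: "'e \<Rightarrow> 'e" and l l' \<epsilon> u
  proof
    fix x
    have "T (T' x) - scaleC l (T' x) = scaleC (- l) (T' x - scaleC l' x)"
      by (simp add: T scaleC_diff_right scaleC_minus_left scaleC_scaleC)
    then have "cmod (cinner (T' x - scaleC l' x) u) = cmod (cinner (T (T' x) - scaleC l (T' x)) u)"
      using l by (simp only: cinner_scaleC_left norm_mult) simp
    also have "\<dots> \<le> \<epsilon> * norm (T' x) * norm u" by (rule u)
    also have "\<dots> \<le> \<epsilon> * norm x * norm u"
      using T(3)[of x] eps by (intro mult_right_mono mult_left_mono) auto
    finally show "cmod (cinner (T' x - scaleC l' x) u) \<le> \<epsilon> * norm x * norm u" .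
  qed
  have pos: "(norm e)\<^sup>2 > 0" using e by simp
  show ?thesis
  proof (cases "cmod l1 = 1")
    case True
    define w where "w m = (U ^^ Suc m) e" for m
    have orth: "cinner (w m) (w k) = (if m = k then complex_of_real ((norm e)\<^sup>2) else 0)" for m k
      using cinner_U_funpow[of "Suc m" "Suc k"] by (simp only: w_def nat.inject)
    have shift: "cinner (phi1 P U z x) (w m) = cinner x (w (Suc m))" for x m
    proof -
      have "P (w (Suc m)) = 0" unfolding w_def by (rule P_U_funpow)
      moreover have "cinner (phi1 P U z x) (w m) = cinner (x - P x + scaleC z (P x)) (w (Suc m))"
        by (simp add: phi1_def adj_unitary(4)[OF U] w_def)
      ultimately show ?thesis
        by (simp add: cinner_add_left cinner_diff_left cinner_scaleC_left orth_projection_selfadj[OF P])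
    qed
    show ?thesis
      unfolding approx_left_eigen_def
    proof (intro allI impI)
      fix \<epsilon> :: real assume eps: "\<epsilon> > 0"
      obtain u where u: "u \<noteq> 0"
        "\<And>x. cmod (cinner (phi1 P U z x - scaleC l1 x) u) \<le> \<epsilon> * norm x * norm u"
        using shift_approx_left_eigen[OF orth pos shift True eps] by metis
      then show "\<exists>u\<in>UNIV. u \<noteq> 0 \<and>
          (\<forall>x. cmod (cinner (phi1 P U z x - scaleC l1 x) u) \<le> \<epsilon> * norm x * norm u) \<and>
          (\<forall>x. cmod (cinner (phi2 P U z x - scaleC l2 x) u) \<le> \<epsilon> * norm x * norm u)"
        using transfer[OF clinear_phi(1) _ _ True eps u(2), of "phi2 P U z" l2] z phi2_contraction[of z]
        by (auto simp: phi1_phi2)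
    qed
  next
    case False
    then have l2: "cmod l2 = 1" using l by simp
    define w where "w m = (adj U ^^ m) e" for m
    have orth: "cinner (w m) (w k) = (if m = k then complex_of_real ((norm e)\<^sup>2) else 0)" for m k
      using cinner_adj_funpow[of m k] by (simp only: w_def)
    have shift: "cinner (phi2 P U z x) (w m) = cinner x (w (Suc m))" for x m
    proof -
      have Pw: "P (w m) = w m" unfolding w_def by (rule P_adj_funpow)
      have "cinner (phi2 P U z x) (w m) = cinner (U x) (w m)"
        by (simp add: phi2_def cinner_add_left cinner_diff_left cinner_scaleC_left
            orth_projection_selfadj[OF P] Pw)
      then show ?thesis by (simp add: adj_unitary(3)[OF U] w_def)
    qed
    show ?thesis
      unfolding approx_left_eigen_def
    proof (intro allI impI)
      fix \<epsilon> :: real assume eps: "\<epsilon> > 0"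
      obtain u where u: "u \<noteq> 0"
        "\<And>x. cmod (cinner (phi2 P U z x - scaleC l2 x) u) \<le> \<epsilon> * norm x * norm u"
        using shift_approx_left_eigen[OF orth pos shift l2 eps] by metis
      then show "\<exists>u\<in>UNIV. u \<noteq> 0 \<and>
          (\<forall>x. cmod (cinner (phi1 P U z x - scaleC l1 x) u) \<le> \<epsilon> * norm x * norm u) \<and>
          (\<forall>x. cmod (cinner (phi2 P U z x - scaleC l2 x) u) \<le> \<epsilon> * norm x * norm u)"
        using transfer[OF clinear_phi(2) _ _ l2 eps u(2), of "phi1 P U z" l1] z phi1_contraction[of z]
        by (auto simp: phi2_phi1 mult.commute)
    qed
  qed
qed

lemma taylor_spectrum_phi:
  assumes z: "cmod z < 1"
  shows "taylor_spectrum UNIV scaleC (phi1 P U z) (phi2 P U z)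
    = {(l1, l2). cmod l1 \<le> 1 \<and> cmod l2 \<le> 1 \<and> l1 * l2 = z}"
proof -
  let ?ex = "\<lambda>l1 l2. koszul_exact UNIV (\<lambda>x. phi1 P U z x - scaleC l1 x) (\<lambda>x. phi2 P U z x - scaleC l2 x)"
  have "?ex l1 l2 \<longleftrightarrow> \<not> (cmod l1 \<le> 1 \<and> cmod l2 \<le> 1 \<and> l1 * l2 = z)" for l1 l2
  proof -
    consider (outside) "cmod l1 > 1 \<or> cmod l2 > 1" | (product) "l1 * l2 \<noteq> z"
      | (inside) "cmod l1 < 1" "cmod l2 < 1" "l1 * l2 = z"
      | (boundary) "cmod l1 \<le> 1" "cmod l2 \<le> 1" "cmod l1 = 1 \<or> cmod l2 = 1" "l1 * l2 = z"
      by fastforce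
    then show ?thesis
    proof cases
      case outside
      have "?ex l1 l2"
        using z outside by (intro koszul_exact_outside_bidisc)
          (auto simp: clinear_phi phi1_contraction phi2_contraction closed_csubspace_UNIV phi1_phi2 phi2_phi1)
      then show ?thesis using outside by auto
    next
      case product
      define d where "d = z - l1 * l2"
      have d: "d \<noteq> 0" using product by (simp add: d_def)
      have "?ex l1 l2"
      \<comment> \<open>By \<open>phi1 phi2 = z\<close>, the sum
        \<open>l2 (phi1 - l1) + phi1 (phi2 - l2)\<close> collapses to the scalar
        \<open>z - l1 l2\<close>, which is \<open>d\<close>.\<close>
      proof (rule koszul_exact_if_bezout[where A' = "scaleC (l2 / d)"
            and B' = "\<lambda>x. scaleC (1 / d) (phi1 P U z x)"])
        show "scaleC (l2 / d) (phi1 P U z x - scaleC l1 x)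
            + scaleC (1 / d) (phi1 P U z (phi2 P U z x - scaleC l2 x)) = x" for x
        proof -
          have "scaleC (l2 / d) (phi1 P U z x - scaleC l1 x)
              + scaleC (1 / d) (phi1 P U z (phi2 P U z x - scaleC l2 x))
              = scaleC (z / d) x - scaleC (l1 * l2 / d) x"
            by (simp add: clinear_simps clinear_phi phi1_phi2 scaleC_diff_right scaleC_scaleC mult.commute)
          also have "\<dots> = scaleC (z / d - l1 * l2 / d) x" by (rule scaleC_diff_left[symmetric])
          also have "z / d - l1 * l2 / d = 1" using d by (simp add: d_def flip: diff_divide_distrib)
          finally show ?thesis by (simp add: scaleC_one)
        qed
      qed (auto simp: additive_endo_def clinear_simps clinear_phi phi1_phi2 phi2_phi1
          scaleC_add_right scaleC_diff_right scaleC_scaleC mult.commute)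
      then show ?thesis using product by simp
    next
      case inside
      then obtain x where "x \<noteq> 0" "phi1 P U z x = scaleC l1 x" "phi2 P U z x = scaleC l2 x"
        using joint_eigenvalue_phi[of l1 l2] by (auto simp: joint_eigenvalue_def)
      then have "x \<in> koszul_ker1 UNIV (\<lambda>x. phi1 P U z x - scaleC l1 x) (\<lambda>x. phi2 P U z x - scaleC l2 x)"
        by (simp add: koszul_ker1_def)
      then show ?thesis using inside \<open>x \<noteq> 0\<close> by (auto simp: koszul_exact_def)
    next
      case boundary
      have "\<not> ?ex l1 l2"
        by (rule approx_left_eigen_not_exact[OF closed_csubspace_UNIV approx_left_eigen_phi])
          (use boundary z in auto)
      then show ?thesis using boundary by simp
    qed
  qed
  then show ?thesis unfolding taylor_spectrum_def by auto
qed

end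

subsection \<open>Berger--Coburn--Lebow pairs\<close>

definition hardy2_const :: "'e::complex_inner \<Rightarrow> nat \<Rightarrow> 'e" where
  "hardy2_const a = (\<lambda>n. if n = 0 then a else 0)"

definition hardy2_shift :: "(nat \<Rightarrow> 'e::complex_inner) \<Rightarrow> nat \<Rightarrow> 'e" where
  "hardy2_shift f = (\<lambda>n. if n = 0 then 0 else f (n - 1))"

lemma hardy2_const_mem: "hardy2_const a \<in> hardy2"
  unfolding hardy2_def hardy2_const_def by (auto intro!: summable_finite[of "{0}"] split: if_splits)

lemma hardy2_tail_mem: "f \<in> hardy2 \<Longrightarrow> (\<lambda>n. f (Suc n)) \<in> hardy2"
  using summable_Suc_iff[of "\<lambda>n. (norm (f n))\<^sup>2"] by (simp add: hardy2_def)

lemma hardy2_norm_sq: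
  assumes "f \<in> hardy2"
  shows "(hardy2_norm f)\<^sup>2 = (norm (f 0))\<^sup>2 + (\<Sum>n. (norm (f (Suc n)))\<^sup>2)"
proof -
  have "(hardy2_norm f)\<^sup>2 = (\<Sum>n. (norm (f n))\<^sup>2)"
    using assms by (simp add: hardy2_norm_def hardy2_def suminf_nonneg)
  also have "\<dots> = (norm (f 0))\<^sup>2 + (\<Sum>n. (norm (f (Suc n)))\<^sup>2)"
    using suminf_split_head[of "\<lambda>n. (norm (f n))\<^sup>2"] assms by (simp add: hardy2_def)
  finally show ?thesis .
qed

locale bcl_pair =
  fixes V1 V2 :: "'h::chilbert \<Rightarrow> 'h" and P U :: "'e::chilbert \<Rightarrow> 'e"
    and Hp Hu :: "'h set" and W :: "'h \<Rightarrow> nat \<Rightarrow> 'e"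
  assumes V1: "isometry_op V1" and V2: "isometry_op V2"
    and comm: "V1 (V2 x) = V2 (V1 x)"
    and P: "orth_projection P" and U: "unitary_op U"
    and Hp: "closed_csubspace Hp" and Hu: "closed_csubspace Hu"
    and orth: "x \<in> Hp \<Longrightarrow> y \<in> Hu \<Longrightarrow> cinner x y = 0"
    and sum: "\<exists>x\<in>Hp. \<exists>y\<in>Hu. h = x + y"
    and V_Hp: "V1 ` Hp \<subseteq> Hp" "V2 ` Hp \<subseteq> Hp"
    and V_Hu: "V1 ` Hu = Hu" "V2 ` Hu = Hu"
    and W_bij: "bij_betw W Hp hardy2"
    and W_add: "x \<in> Hp \<Longrightarrow> y \<in> Hp \<Longrightarrow> W (x + y) = W x + W y"
    and W_scale: "x \<in> Hp \<Longrightarrow> W (scaleC c x) = hardy2_scale c (W x)"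
    and W_norm: "x \<in> Hp \<Longrightarrow> hardy2_norm (W x) = norm x"
    and W_V1: "x \<in> Hp \<Longrightarrow> W (V1 x) = M_phi1 P U (W x)"
    and W_V2: "x \<in> Hp \<Longrightarrow> W (V2 x) = M_phi2 P U (W x)"
begin

lemmas E_simps = clinear_simps[OF orth_projection_clinear[OF P]]
  clinear_simps[OF isometry_clinear[OF unitary_isometry[OF U]]]
  clinear_simps[OF isometry_clinear[OF adj_unitary(5)[OF U]]]
  orth_projection_idem[OF P] adj_unitary(1,2)[OF U]
  scaleC_add_right scaleC_diff_right scaleC_scaleC

lemmas V_simps = clinear_simps[OF isometry_clinear[OF V1]] clinear_simps[OF isometry_clinear[OF V2]]

lemma orth': "y \<in> Hu \<Longrightarrow> x \<in> Hp \<Longrightarrow> cinner y x = 0"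
  using orth[of x y] by (subst cinner_commute) simp

lemma V_Hp_mem: "x \<in> Hp \<Longrightarrow> V1 x \<in> Hp" "x \<in> Hp \<Longrightarrow> V2 x \<in> Hp"
  using V_Hp by auto

lemma V_Hu_mem: "x \<in> Hu \<Longrightarrow> V1 x \<in> Hu" "x \<in> Hu \<Longrightarrow> V2 x \<in> Hu"
  using V_Hu by auto

lemmas Hp_mem = csubspace_add[OF Hp] csubspace_scaleC[OF Hp] csubspace_zero[OF Hp]
  csubspace_minus[OF Hp] csubspace_diff[OF Hp] V_Hp_mem
lemmas Hu_mem = csubspace_add[OF Hu] csubspace_scaleC[OF Hu] csubspace_zero[OF Hu]
  csubspace_minus[OF Hu] csubspace_diff[OF Hu] V_Hu_mem

lemma W_eqI: "x \<in> Hp \<Longrightarrow> y \<in> Hp \<Longrightarrow> W x = W y \<Longrightarrow> x = y"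
  using W_bij by (auto simp: bij_betw_def inj_on_def)

lemma W_mem: "x \<in> Hp \<Longrightarrow> W x \<in> hardy2"
  using W_bij by (auto simp: bij_betw_def)

lemma W_diff: "x \<in> Hp \<Longrightarrow> y \<in> Hp \<Longrightarrow> W (x - y) = W x - W y"
  using W_add[of x "scaleC (-1) y"] W_scale[of y "-1"]
  by (simp add: Hp_mem scaleC_minus_one hardy2_scale_def fun_eq_iff)

lemma W_V1_V2:
  assumes x: "x \<in> Hp" shows "W (V1 (V2 x)) = hardy2_shift (W x)"
proof
  fix n
  have "W (V1 (V2 x)) = M_phi1 P U (M_phi2 P U (W x))"
    using x by (simp add: W_V1 W_V2 Hp_mem)
  then show "W (V1 (V2 x)) n = hardy2_shift (W x) n"
    by (cases n) (auto simp: M_phi1_def M_phi2_def mult_op_def hardy2_shift_def E_simps)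
qed

text \<open>Embeds the coefficient space as the constant functions of the model, that is, as the
  wandering space of \<open>V1 V2\<close>.\<close>

definition \<iota> :: "'e \<Rightarrow> 'h" where "\<iota> a = inv_into Hp W (hardy2_const a)"

lemma iota_mem: "\<iota> a \<in> Hp"
  and W_iota: "W (\<iota> a) = hardy2_const a"
  using hardy2_const_mem[of a] W_bij
  by (auto simp: \<iota>_def bij_betw_def inv_into_into f_inv_into_f)

lemma iota_diff: "\<iota> (a - b) = \<iota> a - \<iota> b"
  by (rule W_eqI) (auto simp: iota_mem Hp_mem W_iota W_diff hardy2_const_def)

lemma iota_scaleC: "\<iota> (scaleC c a) = scaleC c (\<iota> a)"
  by (rule W_eqI) (auto simp: iota_mem Hp_mem W_iota W_scale hardy2_const_def hardy2_scale_def)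

lemma iota_zero: "\<iota> 0 = 0"
  using iota_diff[of 0 0] by simp

text \<open>\<open>W\<close> is only known to preserve norms, so this is polarization again: adding
  \<open>\<iota> a\<close> to \<open>x\<close> changes only the coefficient at 0.\<close>

lemma cinner_iota:
  assumes x: "x \<in> Hp" shows "cinner x (\<iota> a) = cinner (W x 0) a"
proof -
  have norm: "(norm y)\<^sup>2 = (norm (W y 0))\<^sup>2 + (\<Sum>n. (norm (W y (Suc n)))\<^sup>2)" if "y \<in> Hp" for y
    using hardy2_norm_sq[OF W_mem[OF that]] W_norm[OF that] by simp
  have Re: "Re (cinner x (\<iota> a)) = Re (cinner (W x 0) a)" for a
    using norm[OF x] norm[OF iota_mem[of a]] norm[OF Hp_mem(1)[OF x iota_mem[of a]]]
      norm_add_sq[of x "\<iota> a"] norm_add_sq[of "W x 0" a]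
    by (simp add: W_add x iota_mem W_iota hardy2_const_def)
  have "Im (cinner x (\<iota> a)) = Im (cinner (W x 0) a)"
    using Re[of "scaleC (- \<i>) a"] by (simp add: iota_scaleC cinner_scaleC_right)
  then show ?thesis using Re by (simp add: complex_eq_iff)
qed

lemma cinner_iota_iota: "cinner (\<iota> a) (\<iota> b) = cinner a b"
  by (simp add: cinner_iota iota_mem W_iota hardy2_const_def)

text \<open>The hypothesis removes the linear term of the symbol, so constants stay constants;
  likewise for \<open>V2_iota\<close>.\<close>

lemma V1_iota: "P b = 0 \<Longrightarrow> V1 (\<iota> b) = \<iota> (adj U b)"
  by (rule W_eqI)
    (auto simp: iota_mem Hp_mem W_V1 W_iota M_phi1_def mult_op_def hardy2_const_def E_simps)

lemma V2_iota: "P (U b) = U b \<Longrightarrow> V2 (\<iota> b) = \<iota> (U b)"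
  by (rule W_eqI)
    (auto simp: iota_mem Hp_mem W_V2 W_iota M_phi2_def mult_op_def hardy2_const_def E_simps)

text \<open>The adjoint of \<open>V1\<close> on constants, obtained before adjoints are known to
  exist. The part of \<open>x\<close> in \<open>Hu\<close> pairs to zero on both sides.\<close>

lemma cinner_V1_iota: "cinner (V1 x) (\<iota> a) = cinner x (\<iota> (U a - P (U a)))"
proof -
  obtain y w where x: "x = y + w" "y \<in> Hp" "w \<in> Hu" using sum by blast
  have "cinner (V1 y) (\<iota> a) = cinner y (\<iota> (U a - P (U a)))"
    using x by (simp add: cinner_iota Hp_mem W_V1 M_phi1_def mult_op_def adj_unitary(4)[OF U]
        cinner_diff_left cinner_diff_right orth_projection_selfadj[OF P])
  then show ?thesis
    using x by (simp add: V_simps cinner_add_left orth' Hu_mem iota_mem)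
qed

lemma cinner_V2_iota: "cinner (V2 x) (\<iota> a) = cinner x (\<iota> (adj U (P a)))"
proof -
  obtain y w where x: "x = y + w" "y \<in> Hp" "w \<in> Hu" using sum by blast
  have "cinner (V2 y) (\<iota> a) = cinner y (\<iota> (adj U (P a)))"
    using x by (simp add: cinner_iota Hp_mem W_V2 M_phi2_def mult_op_def adj_unitary(3)[OF U]
        orth_projection_selfadj[OF P])
  then show ?thesis
    using x by (simp add: V_simps cinner_add_left orth' Hu_mem iota_mem)
qed

text \<open>On \<open>Hp\<close> this splits a power series into its constant term and the variable
  times a series; on \<open>Hu\<close> the product \<open>V1 V2\<close> is onto.\<close>

lemma decomposition: obtains a x where "h = \<iota> a + V1 (V2 x)"
proof -
  obtain y w where h: "h = y + w" "y \<in> Hp" "w \<in> Hu" using sum by blast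
  obtain v' where "w = V1 v'" "v' \<in> Hu" using h(3) V_Hu(1) by (metis imageE)
  moreover from this obtain v where "v' = V2 v" using V_Hu(2) by (metis imageE)
  ultimately have v: "w = V1 (V2 v)" by simp
  obtain x where x: "x \<in> Hp" "W x = (\<lambda>n. W y (Suc n))"
    using hardy2_tail_mem[OF W_mem[OF h(2)]] W_bij by (metis bij_betw_imp_surj_on imageE)
  have "y = \<iota> (W y 0) + V1 (V2 x)"
    by (rule W_eqI)
      (auto simp: h x iota_mem Hp_mem W_add W_iota W_V1_V2 hardy2_const_def hardy2_shift_def)
  then have "h = \<iota> (W y 0) + V1 (V2 (x + v))"
    by (simp add: h(1) v V_simps)
  then show ?thesis using that by blast
qed

text \<open>\<open>adj\<close> is a definite description, so an adjoint has to be exhibited. On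
  constants it is given by \<open>cinner_V1_iota\<close> and \<open>cinner_V2_iota\<close>; on the
  range of \<open>V1 V2\<close> the isometry property cancels a factor.\<close>

lemma cinner_adj: "cinner (V1 x) y = cinner x (adj V1 y)" "cinner (V2 x) y = cinner x (adj V2 y)"
proof -
  have "\<exists>w. \<forall>x. cinner (V1 x) h = cinner x w" for h
  proof -
    obtain a y where "h = \<iota> a + V1 (V2 y)" by (rule decomposition)
    then have "cinner (V1 x) h = cinner x (\<iota> (U a - P (U a)) + V2 y)" for x
      by (simp add: cinner_add_right cinner_V1_iota isometry_cinner[OF V1])
    then show ?thesis by blast
  qed
  then obtain S1 where S1: "\<And>x h. cinner (V1 x) h = cinner x (S1 h)" by metis
  show "cinner (V1 x) y = cinner x (adj V1 y)" using adj_eqI[OF S1] S1 by simp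
  have "\<exists>w. \<forall>x. cinner (V2 x) h = cinner x w" for h
  proof -
    obtain a y where "h = \<iota> a + V1 (V2 y)" by (rule decomposition)
    then have "cinner (V2 x) h = cinner x (\<iota> (adj U (P a)) + V1 y)" for x
      by (simp add: cinner_add_right cinner_V2_iota comm isometry_cinner[OF V2])
    then show ?thesis by blast
  qed
  then obtain S2 where S2: "\<And>x h. cinner (V2 x) h = cinner x (S2 h)" by metis
  show "cinner (V2 x) y = cinner x (adj V2 y)" using adj_eqI[OF S2] S2 by simp
qed

lemma adj_V:
  "adj V1 (V1 x) = x" "adj V2 (V2 x) = x"
  "adj V1 (x + y) = adj V1 x + adj V1 y" "adj V2 (x + y) = adj V2 x + adj V2 y"
  "adj V1 (\<iota> a) = \<iota> (U a - P (U a))" "adj V2 (\<iota> a) = \<iota> (adj U (P a))"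
  by (rule cinner_eqI_left; simp add: cinner_add_right isometry_cinner[OF V1] isometry_cinner[OF V2]
      cinner_V1_iota cinner_V2_iota flip: cinner_adj)+

lemma defect_iota: "defect_op V1 V2 (\<iota> a) = \<iota> (adj U (P (U a)) - P a)"
proof -
  have "V1 (adj V1 (\<iota> a)) = \<iota> (a - adj U (P (U a)))"
    by (simp add: adj_V V1_iota E_simps)
  moreover have "V2 (adj V2 (\<iota> a)) = \<iota> (P a)"
    by (simp add: adj_V V2_iota E_simps)
  moreover have "adj V2 (adj V1 (\<iota> a)) = 0"
    by (simp add: adj_V E_simps iota_zero)
  ultimately show ?thesis by (simp add: defect_op_def iota_diff V_simps)
qed

text \<open>On the range of \<open>V1 V2\<close> all four terms of the defect operator equal the
  vector itself up to sign, and they cancel.\<close>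

lemma defect_decomposition: "defect_op V1 V2 (\<iota> a + V1 (V2 x)) = defect_op V1 V2 (\<iota> a)"
proof -
  have "adj V1 (V1 (V2 x)) = V2 x" "adj V2 (V1 (V2 x)) = V1 x"
    by (rule adj_V) (simp add: adj_V comm)
  then show ?thesis by (simp add: defect_op_def adj_V V_simps comm)
qed

text \<open>For \<open>P a = 0\<close> the quadratic form of the defect at \<open>\<iota> a\<close>
  is the squared norm of \<open>P (U a)\<close>, so nonpositivity forces \<open>P (U a) = 0\<close>.
  Then \<open>adj U\<close> preserves the range of \<open>P\<close>, and the defect on constants is
  minus the projection onto the part of that range orthogonal to its image under
  \<open>adj U\<close>. Any nonzero value of it serves as \<open>e\<close>.\<close>

lemma negative_corner:
  assumes "op_nonpos (defect_op V1 V2)" and "defect_op V1 V2 \<noteq> (\<lambda>x. 0)"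
  obtains e where "negative_bcl_triple P U e"
proof -
  have kerP: "P (U a) = 0" if "P a = 0" for a
  proof -
    have "cinner (defect_op V1 V2 (\<iota> a)) (\<iota> a) = cinner (adj U (P (U a)) - P a) a"
      by (simp add: defect_iota cinner_iota_iota)
    also have "\<dots> = cinner (P (U a)) (P (U a))"
      by (simp add: that adj_unitary(4)[OF U])
        (simp add: orth_projection_selfadj[OF P] orth_projection_idem[OF P])
    finally have "Re (cinner (P (U a)) (P (U a))) \<le> 0"
      using assms(1) unfolding op_nonpos_def by metis
    then show ?thesis by (simp add: cinner_self flip: of_real_power)
  qed
  obtain h where "defect_op V1 V2 h \<noteq> 0" using assms(2) by auto
  moreover obtain a x where "h = \<iota> a + V1 (V2 x)" by (rule decomposition)
  ultimately have "\<iota> (adj U (P (U a)) - P a) \<noteq> 0" by (simp add: defect_decomposition defect_iota)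
  then have nz: "adj U (P (U a)) - P a \<noteq> 0" using iota_zero by metis
  have ranP: "P (adj U (P y)) = adj U (P y)" for y
  proof -
    have "cinner w (adj U (P y) - P (adj U (P y))) = cinner (P (U (w - P w))) y" for w
      by (simp add: cinner_diff_left cinner_diff_right orth_projection_selfadj[OF P]
          adj_unitary(3)[OF U] E_simps)
    moreover have "P (U (w - P w)) = 0" for w by (rule kerP) (simp add: E_simps)
    ultimately show ?thesis
      using cinner_eqI_left[of "adj U (P y) - P (adj U (P y))" 0] by simp
  qed
  have "negative_bcl_triple P U (adj U (P (U a)) - P a)"
  proof
    show "P (adj U (P (U a)) - P a) = adj U (P (U a)) - P a"
      using ranP by (simp add: E_simps)
    show "P (U (adj U (P (U a)) - P a)) = 0"
      using kerP[of "a - P a"] by (simp add: E_simps)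
  qed (use P U kerP nz in auto)
  then show ?thesis using that by blast
qed

end

section \<open>Spectrum of the isometric pair and of its Hardy space model\<close>

locale negative_bcl_pair = bcl_pair V1 V2 P U Hp Hu W + negative_bcl_triple P U e
  for V1 V2 :: "'h::chilbert \<Rightarrow> 'h" and P U :: "'e::chilbert \<Rightarrow> 'e"
    and Hp Hu :: "'h set" and W :: "'h \<Rightarrow> nat \<Rightarrow> 'e" and e :: 'e
begin

text \<open>For \<open>cmod l1 = 1\<close> the constants given by \<open>U ^^ m\<close> applied to
  \<open>e\<close> are used: from \<open>m = 1\<close> on they lie in the kernel of
  \<open>P\<close>, where \<open>V1\<close> moves them back and the adjoint of \<open>V2\<close>
  vanishes. For \<open>cmod l2 = 1\<close> the powers of \<open>adj U\<close> do the same with the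
  isometries exchanged.\<close>

lemma approx_left_eigen_V:
  assumes l: "cmod l1 \<le> 1" "cmod l2 \<le> 1" "cmod l1 = 1 \<or> cmod l2 = 1"
  shows "approx_left_eigen Hp V1 V2 l1 l2"
proof -
  have pos: "(norm e)\<^sup>2 > 0" using e by simp
  show ?thesis
  proof (cases "cmod l1 = 1")
    case True
    show ?thesis
    proof (rule approx_left_eigen_isometries[where a = "\<lambda>m. \<iota> ((U ^^ m) e)"])
      show "cinner (\<iota> ((U ^^ m) e)) (\<iota> ((U ^^ k) e)) = (if m = k then complex_of_real ((norm e)\<^sup>2) else 0)"
        for m k by (simp only: cinner_iota_iota cinner_U_funpow)
      show "V1 (\<iota> ((U ^^ Suc m) e)) = \<iota> ((U ^^ m) e)" for m
        by (subst V1_iota[OF P_U_funpow]) (simp add: adj_unitary[OF U])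
      show "cinner (V2 x) (\<iota> ((U ^^ Suc m) e)) = 0" for m x
        unfolding cinner_V2_iota P_U_funpow by (simp add: lin_simps iota_zero)
    qed (use V1 V2 comm Hp V_Hp iota_mem pos True l in auto)
  next
    case False
    then have l2: "cmod l2 = 1" using l by simp
    have U_adj: "U ((adj U ^^ Suc m) e) = (adj U ^^ m) e" for m
      by (simp add: adj_unitary[OF U])
    show ?thesis
    proof (rule approx_left_eigen_swap,
        rule approx_left_eigen_isometries[where a = "\<lambda>m. \<iota> ((adj U ^^ m) e)"])
      show "cinner (\<iota> ((adj U ^^ m) e)) (\<iota> ((adj U ^^ k) e)) = (if m = k then complex_of_real ((norm e)\<^sup>2) else 0)"
        for m k by (simp only: cinner_iota_iota cinner_adj_funpow)
      show "V2 (\<iota> ((adj U ^^ Suc m) e)) = \<iota> ((adj U ^^ m) e)" for m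
        by (subst V2_iota) (simp_all only: U_adj P_adj_funpow)
      show "cinner (V1 x) (\<iota> ((adj U ^^ Suc m) e)) = 0" for m x
        unfolding cinner_V1_iota U_adj P_adj_funpow by (simp add: iota_zero)
    qed (use V1 V2 comm Hp V_Hp iota_mem pos l2 l in auto)
  qed
qed

text \<open>With \<open>z = l1 l2\<close>, the two linear functions \<open>(\<phi>i - li) x\<close> vanish at \<open>z\<close> for a joint eigenvector
\<open>x\<close> of the fibre over \<open>z\<close>; dividing them by the variable minus \<open>z\<close> yields the constants \<open>b1\<close>, \<open>b2\<close>,
and \<open>(\<iota> b1, \<iota> b2)\<close> is a cycle. A primitive \<open>h\<close> of it would satisfy \<open>\<iota> x = (V1 V2 - z) h\<close>, which
is impossible since the right-hand side vanishes at \<open>z\<close>.\<close>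
lemma breaks_at_stage2_V:
  assumes S: "Hp \<subseteq> S" and l: "cmod l1 < 1" "cmod l2 < 1"
  shows "breaks_at_stage2 S (\<lambda>x. V1 x - scaleC l1 x) (\<lambda>x. V2 x - scaleC l2 x)"
proof -
  define z where "z = l1 * l2"
  obtain x where x: "x \<noteq> 0" "phi1 P U z x = scaleC l1 x" "phi2 P U z x = scaleC l2 x"
    using joint_eigenvalue_phi[OF l] by (auto simp: joint_eigenvalue_def z_def)
  define b1 where "b1 = adj U (P x)"
  define b2 where "b2 = U x - P (U x)"
  have l1Ux: "scaleC l1 (U x) = (x - P x) + scaleC z (P x)"
    using arg_cong[OF x(2), of U] by (simp add: phi1_def lin_simps)
  have zPx: "scaleC l1 (P (U x)) = scaleC z (P x)"
    using arg_cong[OF l1Ux, of P] by (simp add: lin_simps)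
  have l1b2: "scaleC l1 b2 = x - P x"
    by (simp add: b2_def lin_simps l1Ux zPx)
  have PUx: "P (U x) = scaleC l2 (P x)"
    using arg_cong[OF x(3), of P] by (simp add: phi2_def lin_simps)
  have Vb: "V1 (\<iota> b2) - scaleC l1 (\<iota> b2) = V2 (\<iota> b1) - scaleC l2 (\<iota> b1)"
  proof -
    have "V1 (\<iota> b2) = \<iota> (adj U b2)" by (rule V1_iota) (simp add: b2_def lin_simps)
    moreover have "V2 (\<iota> b1) = \<iota> (P x)" by (simp add: V2_iota b1_def lin_simps)
    moreover have "adj U b2 - scaleC l1 b2 = P x - scaleC l2 b1"
      unfolding l1b2 by (simp add: b2_def b1_def lin_simps PUx)
    ultimately show ?thesis by (simp flip: iota_scaleC iota_diff)
  qed
  have "(\<iota> b1, \<iota> b2) \<in> koszul_ker2 S (\<lambda>x. V1 x - scaleC l1 x) (\<lambda>x. V2 x - scaleC l2 x)"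
    using Vb S iota_mem by (auto simp: koszul_ker2_def)
  moreover have "(\<iota> b1, \<iota> b2) \<notin> koszul_ran1 S (\<lambda>x. V1 x - scaleC l1 x) (\<lambda>x. V2 x - scaleC l2 x)"
  proof
    assume "(\<iota> b1, \<iota> b2) \<in> koszul_ran1 S (\<lambda>x. V1 x - scaleC l1 x) (\<lambda>x. V2 x - scaleC l2 x)"
    then obtain h where h: "V1 h - scaleC l1 h = \<iota> b1" by (auto simp: koszul_ran1_def)
    \<comment> \<open>The division by the variable minus \<open>z\<close>, read in the model where
      the variable is \<open>V1 V2\<close>.\<close>
    have V1x: "V1 (\<iota> x) - scaleC l1 (\<iota> x) = V1 (V2 (\<iota> b1)) - scaleC z (\<iota> b1)"
    proof (rule W_eqI)
      show "W (V1 (\<iota> x) - scaleC l1 (\<iota> x)) = W (V1 (V2 (\<iota> b1)) - scaleC z (\<iota> b1))"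
      proof
        fix n
        have eq: "adj U (x - P x) = scaleC l1 x - scaleC z b1"
          using x(2) by (simp add: phi1_def b1_def lin_simps eq_diff_eq)
        have "W (V1 (\<iota> x)) n = (if n = 0 then adj U (x - P x) else if n = 1 then b1 else 0)"
          by (simp add: iota_mem W_V1 W_iota M_phi1_def mult_op_def hardy2_const_def b1_def lin_simps)
        moreover have "W (V1 (V2 (\<iota> b1))) n = (if n = 1 then b1 else 0)"
          by (simp add: iota_mem W_V1_V2 W_iota hardy2_shift_def hardy2_const_def)
        ultimately show "W (V1 (\<iota> x) - scaleC l1 (\<iota> x)) n
            = W (V1 (V2 (\<iota> b1)) - scaleC z (\<iota> b1)) n"
          by (simp add: iota_mem Hp_mem W_diff W_scale W_iota hardy2_scale_def hardy2_const_def eq)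
      qed
    qed (simp_all add: iota_mem Hp_mem)
    \<comment> \<open>\<open>d\<close> is annihilated by \<open>V1 - l1\<close>, hence zero because
      \<open>V1\<close> preserves norms and \<open>cmod l1 < 1\<close>.\<close>
    define d where "d = \<iota> x - (V1 (V2 h) - scaleC z h)"
    have "V1 d - scaleC l1 d
        = (V1 (\<iota> x) - scaleC l1 (\<iota> x)) - (V1 (V2 (V1 h - scaleC l1 h)) - scaleC z (V1 h - scaleC l1 h))"
      by (simp add: d_def V_simps comm scaleC_diff_right scaleC_add_right scaleC_scaleC mult.commute algebra_simps)
    also have "\<dots> = 0" by (simp add: h V1x)
    finally have "norm d = cmod l1 * norm d"
      using isometry_norm[OF V1, of d] by (simp add: norm_scaleC)
    then have "d = 0" using l(1) by auto
    then have ix: "\<iota> x = V1 (V2 h) - scaleC z h" by (simp add: d_def)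
    obtain y w where yw: "h = y + w" "y \<in> Hp" "w \<in> Hu" using sum by blast
    \<comment> \<open>The \<open>Hu\<close> part of \<open>h\<close> drops out: \<open>g\<close>
      lies both in \<open>Hp\<close> and in its orthogonal complement. This reduces the equation to
      power series.\<close>
    define g where "g = \<iota> x - (V1 (V2 y) - scaleC z y)"
    have "g = V1 (V2 w) - scaleC z w"
      by (simp add: g_def ix yw(1) V_simps scaleC_add_right)
    then have "g \<in> Hu" using yw by (simp add: Hu_mem)
    moreover have "g \<in> Hp" using yw by (simp add: g_def iota_mem Hp_mem)
    ultimately have "g = 0" using orth[of g g] by (simp add: cinner_self_eq_zero)
    then have ixy: "\<iota> x = V1 (V2 y) - scaleC z y" by (simp add: g_def)
    define f where "f = W y"
    have coeff: "hardy2_const x n = hardy2_shift f n - scaleC z (f n)" for n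
      using arg_cong[OF ixy, of "\<lambda>v. W v n"] yw(2)
      by (simp add: W_iota W_diff W_scale W_V1_V2 Hp_mem f_def hardy2_scale_def)
    have x0: "x = - scaleC z (f 0)"
      using coeff[of 0] by (simp add: hardy2_const_def hardy2_shift_def)
    have step: "f n = scaleC z (f (Suc n))" for n
      using coeff[of "Suc n"] unfolding hardy2_const_def hardy2_shift_def by simp
    have z: "cmod z \<le> 1" using l by (simp add: z_def norm_mult mult_le_one)
    \<comment> \<open>By the recursion the coefficient norms cannot decrease, yet square summability
      sends them to 0. So \<open>f 0 = 0\<close>, and with it \<open>x = 0\<close>.\<close>
    have "norm (f n) \<le> norm (f (Suc n))" for n
      using step[of n] z by (metis norm_scaleC mult_left_le_one_le norm_ge_zero)
    then have "norm (f 0) \<le> norm (f n)" for n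
      by (rule lift_Suc_mono_le) simp
    moreover have "(\<lambda>n. (norm (f n))\<^sup>2) \<longlonglongrightarrow> 0"
      using W_mem[OF yw(2)] by (intro summable_LIMSEQ_zero) (simp add: hardy2_def f_def)
    then have "(\<lambda>n. norm (f n)) \<longlonglongrightarrow> 0" by simp
    ultimately have "norm (f 0) \<le> 0" by (intro LIMSEQ_le_const) auto
    then show False using x0 x(1) by simp
  qed
  ultimately show ?thesis by (auto simp: breaks_at_stage2_def)
qed

lemma Hp_projection: "\<exists>p\<in>Hp. \<forall>u\<in>Hp. cinner g u = cinner p u"
proof -
  obtain y w where "g = y + w" "y \<in> Hp" "w \<in> Hu" using sum by blast
  then show ?thesis by (intro bexI[of _ y]) (auto simp: cinner_add_left orth')
qed

text \<open>\<open>S\<close> is left free because two cases are needed: the whole space for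
  \<open>(V1, V2)\<close>, and \<open>Hp\<close> for the multiplication operators.\<close>

lemma taylor_spectrum_V:
  assumes S: "closed_csubspace S" "Hp \<subseteq> S" "V1 ` S \<subseteq> S" "V2 ` S \<subseteq> S"
  shows "taylor_spectrum S scaleC V1 V2 = {(l1, l2). cmod l1 \<le> 1 \<and> cmod l2 \<le> 1}"
proof -
  let ?ex = "\<lambda>l1 l2. koszul_exact S (\<lambda>x. V1 x - scaleC l1 x) (\<lambda>x. V2 x - scaleC l2 x)"
  have "?ex l1 l2 \<longleftrightarrow> \<not> (cmod l1 \<le> 1 \<and> cmod l2 \<le> 1)" for l1 l2
  proof -
    consider (outside) "cmod l1 > 1 \<or> cmod l2 > 1" | (inside) "cmod l1 < 1" "cmod l2 < 1"
      | (boundary) "cmod l1 \<le> 1" "cmod l2 \<le> 1" "cmod l1 = 1 \<or> cmod l2 = 1"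
      by fastforce
    then show ?thesis
    proof cases
      case outside
      have "?ex l1 l2"
        using S outside V1 V2 comm
        by (intro koszul_exact_outside_bidisc) (auto simp: isometry_clinear isometry_norm)
      then show ?thesis using outside by auto
    next
      case inside
      then show ?thesis
        using breaks_at_stage2_V[OF S(2), of l1 l2] by (auto simp: breaks_at_stage2_def koszul_exact_def)
    next
      case boundary
      have "\<not> ?ex l1 l2"
        by (rule approx_left_eigen_not_exact[OF Hp approx_left_eigen_V Hp_projection S(2)])
          (use boundary in auto)
      then show ?thesis using boundary by simp
    qed
  qed
  then show ?thesis unfolding taylor_spectrum_def by auto
qed

lemma taylor_spectrum_M_phi:
  "taylor_spectrum hardy2 hardy2_scale (M_phi1 P U) (M_phi2 P U) = taylor_spectrum Hp scaleC V1 V2"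
proof -
  have "koszul_exact hardy2 (\<lambda>f. M_phi1 P U f - hardy2_scale l1 f) (\<lambda>f. M_phi2 P U f - hardy2_scale l2 f)
    \<longleftrightarrow> koszul_exact Hp (\<lambda>x. V1 x - scaleC l1 x) (\<lambda>x. V2 x - scaleC l2 x)" for l1 l2
    by (rule koszul_exact_transfer[OF _ _ W_bij])
      (auto simp: Hp_mem W_diff W_V1 W_V2 W_scale)
  then show ?thesis by (simp add: taylor_spectrum_def)
qed

end

lemma closure_bidisc_product_less_1:
  "closure {(l1, l2). cmod l1 \<le> 1 \<and> cmod l2 \<le> 1 \<and> cmod (l1 * l2) < 1}
    = {(l1, l2). cmod l1 \<le> 1 \<and> cmod l2 \<le> 1}" (is "closure ?A = ?B")
proof
  have "?B = {p. cmod (fst p) \<le> 1} \<inter> {p. cmod (snd p) \<le> 1}" by auto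
  then have "closed ?B"
    by (auto intro!: closed_Int closed_Collect_le continuous_intros)
  then show "closure ?A \<subseteq> ?B" by (intro closure_minimal) auto
  show "?B \<subseteq> closure ?A"
  proof clarify
    fix l1 l2 :: complex assume l: "cmod l1 \<le> 1" "cmod l2 \<le> 1"
    \<comment> \<open>Shrinking one coordinate is enough, since then the modulus of the product is
      at most \<open>r n < 1\<close>.\<close>
    define r where "r n = 1 - inverse (real (Suc n))" for n
    have r: "0 \<le> r n" "r n < 1" for n by (auto simp: r_def field_simps)
    have lim: "r \<longlonglongrightarrow> 1"
      unfolding r_def using tendsto_diff[OF tendsto_const LIMSEQ_inverse_real_of_nat, of 1] by simp
    have mem: "(complex_of_real (r n) * l1, l2) \<in> ?A" for n
    proof -
      have "r n * cmod l1 \<le> r n" using r[of n] l by (intro mult_left_le) auto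
      moreover have "r n * cmod l1 * cmod l2 \<le> r n * cmod l1"
        using r[of n] l by (intro mult_left_le) auto
      ultimately have "r n * cmod l1 \<le> 1" "r n * cmod l1 * cmod l2 < 1"
        using r(2)[of n] by linarith+
      then show ?thesis using r[of n] l by (simp add: norm_mult)
    qed
    have "(\<lambda>n. (complex_of_real (r n) * l1, l2)) \<longlonglongrightarrow> (complex_of_real 1 * l1, l2)"
      by (intro tendsto_intros lim)
    then have "(\<lambda>n. (complex_of_real (r n) * l1, l2)) \<longlonglongrightarrow> (l1, l2)" by simp
    then show "(l1, l2) \<in> closure ?A" unfolding closure_sequential using mem by (intro exI[of _ "\<lambda>n. (complex_of_real (r n) * l1, l2)"] conjI allI)
  qed
qed

theorem theorem3p12:
  fixes V1 V2 :: "'h::chilbert \<Rightarrow> 'h"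
    and P U :: "'e::chilbert \<Rightarrow> 'e"
  assumes "isometry_op V1" and "isometry_op V2"
    and "\<forall>x. V1 (V2 x) = V2 (V1 x)"
    and "op_nonpos (defect_op V1 V2)"
    and "defect_op V1 V2 \<noteq> (\<lambda>x. 0)"
    and "is_BCL_triple V1 V2 P U"
  shows "(\<forall>z. cmod z < 1 \<longrightarrow>
            (\<forall>l1 l2. cmod l1 < 1 \<and> cmod l2 < 1 \<and> l1 * l2 = z \<longrightarrow>
               joint_eigenvalue (phi1 P U z) (phi2 P U z) (l1, l2)) \<and>
            taylor_spectrum UNIV scaleC (phi1 P U z) (phi2 P U z) =
              {(l1, l2). cmod l1 \<le> 1 \<and> cmod l2 \<le> 1 \<and> l1 * l2 = z})
       \<and> taylor_spectrum UNIV scaleC V1 V2 =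
           taylor_spectrum hardy2 hardy2_scale (M_phi1 P U) (M_phi2 P U)
       \<and> taylor_spectrum hardy2 hardy2_scale (M_phi1 P U) (M_phi2 P U) =
           closure (\<Union>z\<in>{z. cmod z < 1}. taylor_spectrum UNIV scaleC (phi1 P U z) (phi2 P U z))
       \<and> closure (\<Union>z\<in>{z. cmod z < 1}. taylor_spectrum UNIV scaleC (phi1 P U z) (phi2 P U z)) =
           {(l1, l2). cmod l1 \<le> 1 \<and> cmod l2 \<le> 1}
       \<and> (\<forall>l1 l2. cmod l1 < 1 \<and> cmod l2 < 1 \<longrightarrow>
            breaks_at_stage2 UNIV (\<lambda>x. V1 x - scaleC l1 x) (\<lambda>x. V2 x - scaleC l2 x))"
proof -
  have "\<exists>Hp Hu W. bcl_pair V1 V2 P U Hp Hu W"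
    using assms(6) unfolding is_BCL_triple_def
    apply (elim conjE exE)
    subgoal for Hp Hu W
      using assms(1-3) by (intro exI[of _ Hp] exI[of _ Hu] exI[of _ W]) (unfold_locales; simp)
    done
  then obtain Hp Hu W where pair: "bcl_pair V1 V2 P U Hp Hu W" by blast
  obtain e where "negative_bcl_triple P U e"
    using bcl_pair.negative_corner[OF pair assms(4,5)] by blast
  with pair interpret negative_bcl_pair V1 V2 P U Hp Hu W e
    by (rule negative_bcl_pair.intro)
  have "(\<Union>z\<in>{z. cmod z < 1}. taylor_spectrum UNIV scaleC (phi1 P U z) (phi2 P U z))
      = {(l1, l2). cmod l1 \<le> 1 \<and> cmod l2 \<le> 1 \<and> cmod (l1 * l2) < 1}"
    using taylor_spectrum_phi by auto
  then have closure: "closure (\<Union>z\<in>{z. cmod z < 1}. taylor_spectrum UNIV scaleC (phi1 P U z) (phi2 P U z))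
      = {(l1, l2). cmod l1 \<le> 1 \<and> cmod l2 \<le> 1}"
    by (simp only: closure_bidisc_product_less_1)
  have "taylor_spectrum UNIV scaleC V1 V2 = {(l1, l2). cmod l1 \<le> 1 \<and> cmod l2 \<le> 1}"
    by (rule taylor_spectrum_V) (auto simp: closed_csubspace_UNIV)
  moreover have "taylor_spectrum hardy2 hardy2_scale (M_phi1 P U) (M_phi2 P U)
      = {(l1, l2). cmod l1 \<le> 1 \<and> cmod l2 \<le> 1}"
    unfolding taylor_spectrum_M_phi by (rule taylor_spectrum_V) (use Hp V_Hp in auto)
  moreover have "\<forall>z. cmod z < 1 \<longrightarrow>
      (\<forall>l1 l2. cmod l1 < 1 \<and> cmod l2 < 1 \<and> l1 * l2 = z \<longrightarrow>
         joint_eigenvalue (phi1 P U z) (phi2 P U z) (l1, l2)) \<and>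
      taylor_spectrum UNIV scaleC (phi1 P U z) (phi2 P U z) =
        {(l1, l2). cmod l1 \<le> 1 \<and> cmod l2 \<le> 1 \<and> l1 * l2 = z}"
    using joint_eigenvalue_phi taylor_spectrum_phi by blast
  ultimately show ?thesis
    using closure breaks_at_stage2_V[OF subset_UNIV] by (simp only:) blast
qed

end
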